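(* Let $G$ be a bipartite connected graph with $n \geq 4$ vertices and $m \geq n$ edges. Then $$Sz(G)-W(G) \geq 4n-8.$$ Moreover, the bound is best possible: equality is attained by the graph composed of a cycle $C_4$ on $4$ vertices and a tree $T$ on $n-3$ vertices sharing a single vertex.
   Context: All graphs are finite, undirected and simple. For vertices $u,v$ of $G=(V,E)$, $d(u,v)$ is the distance between them. The Wiener index is $W(G)=\sum_{\{u,v\}\subseteq V} d(u,v)$. For an edge $e=uv$, let $N_u(e)=\{w\in V: d(u,w)<d(v,w)\}$, $N_v(e)=\{w\in V: d(v,w)<d(u,w)\}$, and $n_u(e)=|N_u(e)|$, $n_v(e)=|N_v(e)|$. The Szeged index is $Sz(G)=\sum_{e=uv\in E} n_u(e)n_v(e)$. *)

theory Defs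
  imports Main
begin

text \<open>
  A graph is given by a vertex set \<open>V\<close> and a set \<open>E\<close> of edges, an edge being the two-element
  set of its ends.
\<close>

definition simple_graph :: "'a set \<Rightarrow> 'a set set \<Rightarrow> bool" where
  "simple_graph V E \<longleftrightarrow> finite V \<and> (\<forall>e\<in>E. e \<subseteq> V \<and> card e = 2)"

definition walk :: "'a set \<Rightarrow> 'a set set \<Rightarrow> 'a list \<Rightarrow> bool" where
  "walk V E xs \<longleftrightarrow> xs \<noteq> [] \<and> set xs \<subseteq> V \<and>
     (\<forall>i. Suc i < length xs \<longrightarrow> {xs ! i, xs ! Suc i} \<in> E)"

definition walk_between :: "'a set \<Rightarrow> 'a set set \<Rightarrow> 'a \<Rightarrow> 'a \<Rightarrow> nat \<Rightarrow> bool" where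
  "walk_between V E u v k \<longleftrightarrow>
     (\<exists>xs. walk V E xs \<and> hd xs = u \<and> last xs = v \<and> length xs = Suc k)"

definition connected_graph :: "'a set \<Rightarrow> 'a set set \<Rightarrow> bool" where
  "connected_graph V E \<longleftrightarrow> V \<noteq> {} \<and> (\<forall>u\<in>V. \<forall>v\<in>V. \<exists>k. walk_between V E u v k)"

definition bipartite :: "'a set \<Rightarrow> 'a set set \<Rightarrow> bool" where
  "bipartite V E \<longleftrightarrow>
     (\<exists>A B. A \<union> B = V \<and> A \<inter> B = {} \<and> (\<forall>e\<in>E. \<exists>a\<in>A. \<exists>b\<in>B. e = {a, b}))"

text \<open>The distance is unspecified for vertices that no walk joins.\<close>

definition gdist :: "'a set \<Rightarrow> 'a set set \<Rightarrow> 'a \<Rightarrow> 'a \<Rightarrow> nat" where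
  "gdist V E u v = (LEAST k. walk_between V E u v k)"

text \<open>
  The value of a symmetric function of two arguments at an unordered pair; the next lemma
  shows that it does not depend on the order in which the two elements are taken.
\<close>

definition at_pair :: "('a \<Rightarrow> 'a \<Rightarrow> nat) \<Rightarrow> 'a set \<Rightarrow> nat" where
  "at_pair f p = (THE k. \<exists>u v. p = {u, v} \<and> u \<noteq> v \<and> k = f u v)"

lemma at_pair_eq:
  assumes "u \<noteq> v" and "f u v = f v u"
  shows "at_pair f {u, v} = f u v"
  unfolding at_pair_def
proof (rule the_equality)
  show "\<exists>x y. {u, v} = {x, y} \<and> x \<noteq> y \<and> f u v = f x y"
    using assms(1) by blast
next
  fix k
  assume "\<exists>x y. {u, v} = {x, y} \<and> x \<noteq> y \<and> k = f x y"
  then show "k = f u v"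
    using assms(2) by (auto simp: doubleton_eq_iff)
qed

lemma walk_rev:
  assumes "walk V E xs"
  shows "walk V E (rev xs)"
proof -
  have "{rev xs ! i, rev xs ! Suc i} \<in> E" if i: "Suc i < length xs" for i
  proof -
    define j where "j = length xs - Suc (Suc i)"
    have "Suc j < length xs" "rev xs ! i = xs ! Suc j" "rev xs ! Suc i = xs ! j"
      using i by (auto simp: j_def rev_nth Suc_diff_Suc)
    then show ?thesis
      using assms by (simp add: walk_def insert_commute)
  qed
  then show ?thesis
    using assms by (simp add: walk_def)
qed

lemma walk_between_sym: "walk_between V E u v k \<longleftrightarrow> walk_between V E v u k"
proof -
  have "walk_between V E b a k" if "walk_between V E a b k" for a b
  proof -
    from that obtain xs where xs: "walk V E xs" "hd xs = a" "last xs = b" "length xs = Suc k"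
      by (auto simp: walk_between_def)
    have "walk V E (rev xs) \<and> hd (rev xs) = b \<and> last (rev xs) = a \<and> length (rev xs) = Suc k"
      using xs by (simp add: walk_rev hd_rev last_rev)
    then show ?thesis
      unfolding walk_between_def by blast
  qed
  then show ?thesis by blast
qed

lemma gdist_sym: "gdist V E u v = gdist V E v u"
  by (simp add: gdist_def walk_between_sym[of V E u v])

definition wiener_index :: "'a set \<Rightarrow> 'a set set \<Rightarrow> nat" where
  "wiener_index V E = (\<Sum>p | p \<subseteq> V \<and> card p = 2. at_pair (gdist V E) p)"

definition closer :: "'a set \<Rightarrow> 'a set set \<Rightarrow> 'a \<Rightarrow> 'a \<Rightarrow> 'a set" where
  "closer V E u v = {w \<in> V. gdist V E u w < gdist V E v w}"

definition szeged_index :: "'a set \<Rightarrow> 'a set set \<Rightarrow> nat" where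
  "szeged_index V E =
     (\<Sum>e\<in>E. at_pair (\<lambda>u v. card (closer V E u v) * card (closer V E v u)) e)"

lemma at_pair_gdist:
  "u \<noteq> v \<Longrightarrow> at_pair (gdist V E) {u, v} = gdist V E u v"
  by (rule at_pair_eq) (auto intro: gdist_sym)

lemma at_pair_closer:
  "u \<noteq> v \<Longrightarrow> at_pair (\<lambda>u v. card (closer V E u v) * card (closer V E v u)) {u, v} =
     card (closer V E u v) * card (closer V E v u)"
  by (rule at_pair_eq) auto

definition cycle_edges :: "'a list \<Rightarrow> 'a set set" where
  "cycle_edges vs = {{vs ! i, vs ! (Suc i mod length vs)} | i. i < length vs}"

definition cycle_graph :: "nat \<Rightarrow> 'a set \<Rightarrow> 'a set set \<Rightarrow> bool" where
  "cycle_graph k V E \<longleftrightarrow>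
     3 \<le> k \<and> (\<exists>vs. distinct vs \<and> length vs = k \<and> V = set vs \<and> E = cycle_edges vs)"

definition acyclic_graph :: "'a set \<Rightarrow> 'a set set \<Rightarrow> bool" where
  "acyclic_graph V E \<longleftrightarrow> \<not> (\<exists>k C F. cycle_graph k C F \<and> C \<subseteq> V \<and> F \<subseteq> E)"

definition tree :: "'a set \<Rightarrow> 'a set set \<Rightarrow> bool" where
  "tree V E \<longleftrightarrow> simple_graph V E \<and> connected_graph V E \<and> acyclic_graph V E"

definition C4_tree_graph :: "nat \<Rightarrow> 'a set \<Rightarrow> 'a set set \<Rightarrow> bool" where
  "C4_tree_graph n V E \<longleftrightarrow>
     (\<exists>C F T D x. cycle_graph 4 C F \<and> tree T D \<and> card T = n - 3 \<and> C \<inter> T = {x} \<and>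
        V = C \<union> T \<and> E = F \<union> D)"

end

theory Submission
  imports Defs
begin

text \<open>
  Call the number of edges separating \<open>x\<close> from \<open>y\<close> minus their distance the excess of \<open>(x, y)\<close>.
  It is nonnegative, as the edges of a geodesic separate its ends, and its sum over all ordered
  pairs is \<open>2 * (Sz - W)\<close>. A bipartite connected graph with at least as many edges as vertices has
  an isometric cycle \<open>C\<close> of some length \<open>2 * k \<ge> 4\<close>. For a vertex \<open>w\<close> whose nearest vertex on \<open>C\<close> is
  \<open>c'\<close>, the excess of \<open>(w, c)\<close> is at least \<open>d c' c\<close> for each \<open>c\<close> on \<open>C\<close>; hence the excesses of \<open>w\<close>
  with the vertices of \<open>C\<close> sum up to at least \<open>k\<^sup>2\<close>, and \<open>Sz - W \<ge> k\<^sup>2 * (n - k) \<ge> 4 * n - 8\<close>.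

  Attaching a pendant vertex \<open>w\<close> at \<open>y\<close> preserves all excesses and gives \<open>w\<close> those of \<open>y\<close>. Growing
  the tree leaf by leaf, the excesses of each vertex with the four-cycle keep summing up to
  exactly \<open>4\<close>, while those within the tree stay \<open>0\<close>.
\<close>

subsection \<open>Walks, distances and geodesics\<close>

lemma walk_snoc:
  assumes "ys \<noteq> []"
  shows "walk V E (ys @ [w]) \<longleftrightarrow> walk V E ys \<and> {last ys, w} \<in> E \<and> w \<in> V"
proof
  assume W: "walk V E (ys @ [w])"
  have "{ys ! i, ys ! Suc i} \<in> E" if "Suc i < length ys" for i
  proof -
    have "{(ys @ [w]) ! i, (ys @ [w]) ! Suc i} \<in> E"
      using W that unfolding walk_def by (metis length_append_singleton less_SucI)
    then show ?thesis using that by (simp add: nth_append)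
  qed
  moreover have "{last ys, w} \<in> E"
  proof -
    define i where "i = length ys - 1"
    have i: "Suc i = length ys" using assms by (simp add: i_def)
    then have "{(ys @ [w]) ! i, (ys @ [w]) ! Suc i} \<in> E"
      using W unfolding walk_def by (metis length_append_singleton lessI)
    then show ?thesis
      using i assms by (simp add: nth_append last_conv_nth i_def)
  qed
  ultimately show "walk V E ys \<and> {last ys, w} \<in> E \<and> w \<in> V"
    using W assms by (simp add: walk_def)
next
  assume R: "walk V E ys \<and> {last ys, w} \<in> E \<and> w \<in> V"
  have "{(ys @ [w]) ! i, (ys @ [w]) ! Suc i} \<in> E" if "Suc i < Suc (length ys)" for i
  proof (cases "Suc i = length ys")
    case True
    then have "i = length ys - 1" by simp
    then show ?thesis using R True assms by (simp add: nth_append last_conv_nth)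
  next
    case False
    then show ?thesis using R that by (auto simp: nth_append walk_def)
  qed
  then show "walk V E (ys @ [w])" using R by (auto simp: walk_def)
qed

lemma walk_between_0: "walk_between V E u v 0 \<longleftrightarrow> u \<in> V \<and> v = u"
proof
  assume "walk_between V E u v 0"
  then show "u \<in> V \<and> v = u"
    by (auto simp: walk_between_def walk_def length_Suc_conv)
next
  assume "u \<in> V \<and> v = u"
  then have "walk V E [u] \<and> hd [u] = u \<and> last [u] = v \<and> length [u] = Suc 0"
    by (simp add: walk_def)
  then show "walk_between V E u v 0" unfolding walk_between_def by blast
qed

lemma walk_between_Suc:
  "walk_between V E u w (Suc k) \<longleftrightarrow> (\<exists>v. walk_between V E u v k \<and> {v, w} \<in> E \<and> w \<in> V)"
proof
  assume "walk_between V E u w (Suc k)"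
  then obtain xs where xs: "walk V E xs" "hd xs = u" "last xs = w" "length xs = Suc (Suc k)"
    by (auto simp: walk_between_def)
  define ys where "ys = butlast xs"
  have ys: "xs = ys @ [w]" "length ys = Suc k" "ys \<noteq> []"
    using xs by (auto simp: ys_def simp flip: length_greater_0_conv)
  have "walk V E ys \<and> hd ys = u \<and> last ys = last ys \<and> length ys = Suc k"
    using xs ys walk_snoc[OF ys(3)] by auto
  moreover have "{last ys, w} \<in> E \<and> w \<in> V" using xs ys walk_snoc[OF ys(3)] by auto
  ultimately show "\<exists>v. walk_between V E u v k \<and> {v, w} \<in> E \<and> w \<in> V"
    unfolding walk_between_def by blast
next
  assume "\<exists>v. walk_between V E u v k \<and> {v, w} \<in> E \<and> w \<in> V"
  then obtain ys where ys: "walk V E ys" "hd ys = u" "{last ys, w} \<in> E" "w \<in> V" "length ys = Suc k"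
    by (auto simp: walk_between_def)
  then have "ys \<noteq> []" by auto
  then have "walk V E (ys @ [w]) \<and> hd (ys @ [w]) = u \<and> last (ys @ [w]) = w
      \<and> length (ys @ [w]) = Suc (Suc k)"
    using ys by (simp add: walk_snoc)
  then show "walk_between V E u w (Suc k)" unfolding walk_between_def by blast
qed

lemma walk_between_in_V:
  assumes "walk_between V E u v k"
  shows "u \<in> V" "v \<in> V"
proof -
  obtain xs where "walk V E xs" "hd xs = u" "last xs = v" using assms by (auto simp: walk_between_def)
  then show "u \<in> V" "v \<in> V" by (auto simp: walk_def)
qed

lemma walk_between_trans:
  "walk_between V E u v k \<Longrightarrow> walk_between V E v w l \<Longrightarrow> walk_between V E u w (k + l)"
proof (induction l arbitrary: w)
  case 0
  then show ?case by (simp add: walk_between_0)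
next
  case (Suc l)
  then show ?case by (auto simp: walk_between_Suc)
qed

lemma gdist_le: "walk_between V E u v k \<Longrightarrow> gdist V E u v \<le> k"
  unfolding gdist_def by (rule Least_le)

lemma simple_graph_edgeD:
  assumes "simple_graph V E" "{u, v} \<in> E"
  shows "u \<in> V" "v \<in> V" "u \<noteq> v"
  using assms by (auto simp: simple_graph_def)

lemma simple_graph_edgeE:
  assumes "simple_graph V E" "e \<in> E"
  obtains u v where "e = {u, v}" "u \<noteq> v" "u \<in> V" "v \<in> V"
proof -
  have "e \<subseteq> V" "card e = 2" using assms by (auto simp: simple_graph_def)
  then show ?thesis using that by (auto simp: card_2_iff)
qed

lemma finite_edges: "simple_graph V E \<Longrightarrow> finite E"
  by (rule finite_subset[of _ "Pow V"]) (auto simp: simple_graph_def)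

text \<open>A potential that grows by at most one along edges and can always be decreased along an
  edge, except at its source, is the distance from its source.\<close>

lemma potential_walk:
  assumes x: "x \<in> V" "g x = (0::nat)"
    and lip: "\<And>u v. {u, v} \<in> E \<Longrightarrow> u \<in> V \<Longrightarrow> v \<in> V \<Longrightarrow> g v \<le> Suc (g u)"
    and desc: "\<And>y. y \<in> V \<Longrightarrow> y \<noteq> x \<Longrightarrow> \<exists>v\<in>V. {v, y} \<in> E \<and> g v < g y"
    and y: "y \<in> V"
  shows "walk_between V E x y (g y)"
  using y
proof (induction "g y" arbitrary: y rule: less_induct)
  case less
  show ?case
  proof (cases "y = x")
    case True
    then show ?thesis using x by (simp add: walk_between_0)
  next
    case False
    then obtain v where v: "v \<in> V" "{v, y} \<in> E" "g v < g y" using desc less.prems by blast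
    then have "g y = Suc (g v)" using lip[of v y] less.prems by simp
    then show ?thesis using less.hyps[OF v(3,1)] v less.prems by (auto simp: walk_between_Suc)
  qed
qed

lemma gdist_eq_potential:
  assumes x: "x \<in> V" "g x = (0::nat)"
    and lip: "\<And>u v. {u, v} \<in> E \<Longrightarrow> u \<in> V \<Longrightarrow> v \<in> V \<Longrightarrow> g v \<le> Suc (g u)"
    and desc: "\<And>y. y \<in> V \<Longrightarrow> y \<noteq> x \<Longrightarrow> \<exists>v\<in>V. {v, y} \<in> E \<and> g v < g y"
    and y: "y \<in> V"
  shows "gdist V E x y = g y"
proof -
  \<comment> \<open>The Lipschitz condition bounds \<open>g\<close> by the length of every walk from
    \<open>x\<close>; descent supplies a walk of exactly that length.\<close>
  have "g z \<le> l" if "walk_between V E x z l" for z l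
    using that
  proof (induction l arbitrary: z)
    case 0
    then show ?case using x by (simp add: walk_between_0)
  next
    case (Suc l)
    then obtain v where v: "walk_between V E x v l" "{v, z} \<in> E" "z \<in> V"
      by (auto simp: walk_between_Suc)
    then have "g v \<le> l" "g z \<le> Suc (g v)"
      using Suc.IH[OF v(1)] lip[OF v(2) walk_between_in_V(2)[OF v(1)] v(3)] by auto
    then show ?case by simp
  qed
  moreover have "walk_between V E x y (g y)" using potential_walk[OF assms] .
  ultimately show ?thesis
    unfolding gdist_def by (intro Least_equality) auto
qed

section \<open>Distances and geodesics in a finite connected graph\<close>

locale fin_conn_graph =
  fixes V :: "'a set" and E
  assumes simple: "simple_graph V E" and conn: "connected_graph V E"
begin

abbreviation d where "d \<equiv> gdist V E"

lemmas edgeD = simple_graph_edgeD[OF simple]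

lemma finite_V: "finite V"
  using simple by (simp add: simple_graph_def)

lemma gdist_walk: "u \<in> V \<Longrightarrow> v \<in> V \<Longrightarrow> walk_between V E u v (d u v)"
  using conn unfolding gdist_def connected_graph_def by (meson LeastI)

lemma gdist_self: "u \<in> V \<Longrightarrow> d u u = 0"
  using gdist_le[of V E u u 0] by (simp add: walk_between_0)

lemma gdist_eq_0: "u \<in> V \<Longrightarrow> v \<in> V \<Longrightarrow> d u v = 0 \<longleftrightarrow> u = v"
  using gdist_walk[of u v] by (auto simp: walk_between_0 gdist_self)

lemma gdist_triangle: "u \<in> V \<Longrightarrow> v \<in> V \<Longrightarrow> w \<in> V \<Longrightarrow> d u w \<le> d u v + d v w"
  by (rule gdist_le, rule walk_between_trans; rule gdist_walk)

lemma gdist_edge: assumes "{u, v} \<in> E" shows "d u v = 1"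
proof -
  have "walk_between V E u v (Suc 0)"
    using edgeD[OF assms] assms by (auto simp: walk_between_Suc walk_between_0)
  then have "d u v \<le> 1" using gdist_le by fastforce
  moreover have "d u v \<noteq> 0" using edgeD[OF assms] gdist_eq_0 by blast
  ultimately show ?thesis by simp
qed

lemma gdist_edge_le: assumes "{u, v} \<in> E" "x \<in> V" shows "d x v \<le> Suc (d x u)"
  using gdist_triangle[of x u v] gdist_edge[OF assms(1)] edgeD[OF assms(1)] assms(2) by simp

lemma gdist_pred:
  assumes "x \<in> V" "y \<in> V" "x \<noteq> y"
  shows "\<exists>v\<in>V. {v, y} \<in> E \<and> d x y = Suc (d x v)"
proof -
  obtain l where l: "d x y = Suc l" using assms gdist_eq_0 not0_implies_Suc by blast
  then obtain v where v: "walk_between V E x v l" "{v, y} \<in> E"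
    using gdist_walk[OF assms(1,2)] by (auto simp: walk_between_Suc)
  have "d x v \<le> l" using gdist_le v(1) .
  moreover have "d x y \<le> Suc (d x v)" using gdist_edge_le v(2) assms(1) .
  ultimately show ?thesis using l v edgeD(1)[OF v(2)] by auto
qed

text \<open>Only the values at \<open>0, ..., k\<close> matter, so a geodesic is prolonged by a
  function update. Requiring the right distance between the two ends alone suffices, by
  \<open>geodesic_dist\<close>.\<close>

definition geodesic :: "(nat \<Rightarrow> 'a) \<Rightarrow> nat \<Rightarrow> bool" where
  "geodesic p k \<longleftrightarrow> (\<forall>i\<le>k. p i \<in> V) \<and> (\<forall>i<k. {p i, p (Suc i)} \<in> E) \<and> d (p 0) (p k) = k"

text \<open>The vertices \<open>p i\<close> and \<open>p j\<close> cut the path into three pieces.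
  The distance across each piece is at most its number of steps, and the three distances sum up to
  at least \<open>k\<close>; so all these bounds are tight.\<close>

lemma geodesic_dist:
  assumes p: "geodesic p k" and ij: "i \<le> j" "j \<le> k"
  shows "d (p i) (p j) = j - i"
proof -
  have V: "p i \<in> V" if "i \<le> k" for i using p that by (simp add: geodesic_def)
  have le: "d (p i) (p (i + l)) \<le> l" if "i + l \<le> k" for i l
    using that
  proof (induction l)
    case 0
    then show ?case by (simp add: gdist_self V)
  next
    case (Suc l)
    have "{p (i + l), p (Suc (i + l))} \<in> E" using p Suc.prems by (simp add: geodesic_def)
    then have "d (p i) (p (Suc (i + l))) \<le> Suc (d (p i) (p (i + l)))"
      using gdist_edge_le V Suc.prems by simp
    then show ?case using Suc by simp
  qed
  have "k \<le> d (p 0) (p i) + d (p i) (p k)"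
    using p gdist_triangle[of "p 0" "p i" "p k"] V ij by (simp add: geodesic_def)
  moreover have "d (p i) (p k) \<le> d (p i) (p j) + d (p j) (p k)"
    using gdist_triangle V ij by simp
  ultimately show ?thesis
    using le[of 0 i] le[of i "j - i"] le[of j "k - j"] ij by simp
qed

lemma geodesic_snoc:
  assumes p: "geodesic p k" and e: "{p k, y} \<in> E" and dy: "d (p 0) y = Suc k"
  shows "geodesic (p(Suc k := y)) (Suc k)"
  using assms edgeD(2)[OF e] unfolding geodesic_def by (auto simp: less_Suc_eq le_Suc_eq)

lemma geodesic_exists:
  assumes "x \<in> V" "y \<in> V"
  obtains p where "geodesic p (d x y)" "p 0 = x" "p (d x y) = y"
proof -
  have "\<exists>p. geodesic p (d x y) \<and> p 0 = x \<and> p (d x y) = y"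
    using assms(2)
  proof (induction "d x y" arbitrary: y)
    case 0
    then have "y = x" using gdist_eq_0 assms(1) by auto
    then show ?case using 0 assms by (auto simp: geodesic_def gdist_self intro!: exI[of _ "\<lambda>_. x"])
  next
    case (Suc l)
    then have "x \<noteq> y" using gdist_self assms(1) by auto
    then obtain v where v: "v \<in> V" "{v, y} \<in> E" "d x y = Suc (d x v)"
      using gdist_pred assms(1) Suc.prems by blast
    then obtain p where p: "geodesic p (d x v)" "p 0 = x" "p (d x v) = v"
      using Suc by (metis Suc_inject)
    then have "geodesic (p(Suc (d x v) := y)) (Suc (d x v))" using geodesic_snoc v by simp
    then show ?case using p v(3) by (intro exI[of _ "p(Suc (d x v) := y)"]) simp
  qed
  then show ?thesis using that by blast
qed

lemma geodesic_rev: 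
  assumes "geodesic p k" shows "geodesic (\<lambda>i. p (k - i)) k"
proof -
  have "{p (k - i), p (k - Suc i)} \<in> E" if "i < k" for i
  proof -
    have "{p (k - Suc i), p (Suc (k - Suc i))} \<in> E" using assms that by (simp add: geodesic_def)
    then show ?thesis using that by (simp add: Suc_diff_Suc insert_commute)
  qed
  then show ?thesis using assms by (simp add: geodesic_def gdist_sym)
qed

end

subsection \<open>Separating edges\<close>

text \<open>The names \<open>u\<close> and \<open>v\<close> range over both orientations of
  \<open>e\<close>, which makes the set symmetric in \<open>x\<close> and \<open>y\<close>.\<close>

definition sep :: "'a set \<Rightarrow> 'a set set \<Rightarrow> 'a \<Rightarrow> 'a \<Rightarrow> 'a set set" where
  "sep V E x y = {e \<in> E. \<exists>u v. e = {u, v} \<and> x \<in> closer V E u v \<and> y \<in> closer V E v u}"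

definition excess :: "'a set \<Rightarrow> 'a set set \<Rightarrow> 'a \<Rightarrow> 'a \<Rightarrow> int" where
  "excess V E x y = int (card (sep V E x y)) - int (gdist V E x y)"

lemma sep_sym: "sep V E x y = sep V E y x"
  by (auto simp: sep_def insert_commute)

lemma excess_sym: "excess V E x y = excess V E y x"
  by (simp add: excess_def sep_sym[of V E x y] gdist_sym[of V E x y])

lemma sep_doubleton_iff:
  "{u, v} \<in> sep V E x y \<longleftrightarrow> {u, v} \<in> E \<and>
     (x \<in> closer V E u v \<and> y \<in> closer V E v u \<or> x \<in> closer V E v u \<and> y \<in> closer V E u v)"
  by (auto simp: sep_def doubleton_eq_iff)

text \<open>Links the two-element sets of the Wiener index to ordered pairs: inserting
  \<open>a\<close> adds the sets \<open>{a, y}\<close>, each counted once as \<open>(a, y)\<close>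
  and once as \<open>(y, a)\<close>.\<close>

lemma sum_ordered_pairs:
  assumes "finite V" and sym: "\<And>x y. f x y = f y x" and diag: "\<And>x. x \<in> V \<Longrightarrow> f x x = (0::nat)"
  shows "(\<Sum>x\<in>V. \<Sum>y\<in>V. f x y) = 2 * (\<Sum>p | p \<subseteq> V \<and> card p = 2. at_pair f p)"
  using assms(1) diag
proof (induction V)
  case empty
  have "{p. p \<subseteq> {} \<and> card p = 2} = {}" by auto
  then show ?case by simp
next
  case (insert a V)
  let ?P = "\<lambda>V. {p. p \<subseteq> V \<and> card p = 2}"
  have P: "?P (insert a V) = ?P V \<union> (\<lambda>y. {a, y}) ` V"
  proof (intro set_eqI iffI)
    fix p assume p: "p \<in> ?P (insert a V)"
    then obtain u v where uv: "p = {u, v}" "u \<noteq> v" by (auto simp: card_2_iff)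
    then show "p \<in> ?P V \<union> (\<lambda>y. {a, y}) ` V" using p by (auto simp: insert_commute)
  next
    fix p assume "p \<in> ?P V \<union> (\<lambda>y. {a, y}) ` V"
    then show "p \<in> ?P (insert a V)" using insert.hyps by (auto simp: card_2_iff)
  qed
  have disj: "?P V \<inter> (\<lambda>y. {a, y}) ` V = {}" using insert.hyps by auto
  have inj: "inj_on (\<lambda>y. {a, y}) V" by (auto simp: inj_on_def doubleton_eq_iff)
  have "(\<Sum>p\<in>?P (insert a V). at_pair f p) = (\<Sum>p\<in>?P V. at_pair f p) + (\<Sum>y\<in>V. at_pair f {a, y})"
    unfolding P using insert.hyps disj
    by (subst sum.union_disjoint) (auto simp: sum.reindex[OF inj])
  also have "(\<Sum>y\<in>V. at_pair f {a, y}) = (\<Sum>y\<in>V. f a y)"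
    using insert.hyps sym by (intro sum.cong refl at_pair_eq) auto
  finally have "2 * (\<Sum>p\<in>?P (insert a V). at_pair f p)
      = (\<Sum>x\<in>V. \<Sum>y\<in>V. f x y) + 2 * (\<Sum>y\<in>V. f a y)"
    using insert by simp
  moreover have "(\<Sum>x\<in>V. f x a) = (\<Sum>y\<in>V. f a y)" using sym by (intro sum.cong) auto
  ultimately show ?case
    using insert by (simp add: sum.distrib)
qed

section \<open>The total excess and its nonnegativity\<close>

context fin_conn_graph
begin

text \<open>Double counting of triples of two vertices and an edge separating them: the ordered
  pairs separated by \<open>{u, v}\<close> form
  \<open>?A \<times> ?B \<union> ?B \<times> ?A\<close>, whose size is twice the term of that edge
  in the Szeged index.\<close>

lemma sum_card_sep: "(\<Sum>x\<in>V. \<Sum>y\<in>V. card (sep V E x y)) = 2 * szeged_index V E"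
proof -
  have fin: "finite E" using finite_edges simple .
  have "(\<Sum>x\<in>V. \<Sum>y\<in>V. card (sep V E x y))
      = (\<Sum>z\<in>V \<times> V. card (sep V E (fst z) (snd z)))"
    by (simp add: sum.cartesian_product case_prod_beta)
  also have "\<dots> = (\<Sum>z\<in>V \<times> V. \<Sum>e\<in>E. of_bool (e \<in> sep V E (fst z) (snd z)))"
  proof (intro sum.cong refl)
    fix z
    have "sep V E (fst z) (snd z) = E \<inter> {e. e \<in> sep V E (fst z) (snd z)}" by (auto simp: sep_def)
    then show "card (sep V E (fst z) (snd z)) = (\<Sum>e\<in>E. of_bool (e \<in> sep V E (fst z) (snd z)))"
      using fin by simp
  qed
  also have "\<dots> = (\<Sum>e\<in>E. \<Sum>z\<in>V \<times> V. of_bool (e \<in> sep V E (fst z) (snd z)))"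
    by (rule sum.swap)
  also have "\<dots> = (\<Sum>e\<in>E. 2 * at_pair (\<lambda>u v. card (closer V E u v) * card (closer V E v u)) e)"
  proof (intro sum.cong refl)
    fix e assume e: "e \<in> E"
    then obtain u v where uv: "e = {u, v}" "u \<noteq> v" using simple_graph_edgeE[OF simple e] by blast
    let ?A = "closer V E u v" and ?B = "closer V E v u"
    have AB: "?A \<subseteq> V" "?B \<subseteq> V" "?A \<inter> ?B = {}" by (auto simp: closer_def)
    have fAB: "finite ?A" "finite ?B" using AB finite_V finite_subset by blast+
    have "(V \<times> V) \<inter> {z. e \<in> sep V E (fst z) (snd z)} = ?A \<times> ?B \<union> ?B \<times> ?A"
      using AB e uv(1) by (auto simp: sep_doubleton_iff)
    moreover have "card (?A \<times> ?B \<union> ?B \<times> ?A) = 2 * (card ?A * card ?B)"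
      using AB fAB by (subst card_Un_disjoint) (auto simp: card_cartesian_product)
    ultimately show "(\<Sum>z\<in>V \<times> V. of_bool (e \<in> sep V E (fst z) (snd z)))
        = 2 * at_pair (\<lambda>u v. card (closer V E u v) * card (closer V E v u)) e"
      using finite_V by (simp add: uv(1) at_pair_closer[OF uv(2)])
  qed
  also have "\<dots> = 2 * szeged_index V E" by (simp add: szeged_index_def sum_distrib_left)
  finally show ?thesis .
qed

lemma sum_excess:
  "(\<Sum>x\<in>V. \<Sum>y\<in>V. excess V E x y) = 2 * (int (szeged_index V E) - int (wiener_index V E))"
proof -
  have "(\<Sum>x\<in>V. \<Sum>y\<in>V. d x y) = 2 * wiener_index V E"
    unfolding wiener_index_def
    by (rule sum_ordered_pairs) (auto simp: finite_V gdist_self intro: gdist_sym)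
  then have "(\<Sum>x\<in>V. \<Sum>y\<in>V. int (d x y)) = 2 * int (wiener_index V E)"
    by (simp flip: of_nat_sum)
  moreover have "(\<Sum>x\<in>V. \<Sum>y\<in>V. int (card (sep V E x y))) = 2 * int (szeged_index V E)"
    using sum_card_sep by (simp flip: of_nat_sum)
  ultimately show ?thesis by (simp add: excess_def sum_subtractf)
qed

lemma geodesic_edge_sep:
  assumes p: "geodesic p k" and t: "t < k"
  shows "{p t, p (Suc t)} \<in> sep V E (p 0) (p k)"
proof -
  have "d (p t) (p 0) = t" "d (p (Suc t)) (p 0) = Suc t"
    "d (p t) (p k) = k - t" "d (p (Suc t)) (p k) = k - Suc t"
    using geodesic_dist[OF p, of 0 t] geodesic_dist[OF p, of 0 "Suc t"]
      geodesic_dist[OF p, of t k] geodesic_dist[OF p, of "Suc t" k] t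
    by (auto simp: gdist_sym[of V E _ "p 0"])
  then show ?thesis
    using p t by (auto simp: sep_doubleton_iff closer_def geodesic_def)
qed

lemma geodesic_inj:
  assumes p: "geodesic p k" shows "inj_on p {..k}"
proof (rule linorder_inj_onI)
  fix i j assume "i < j" "i \<in> {..k}" "j \<in> {..k}"
  then have "d (p i) (p j) \<noteq> 0" using geodesic_dist[OF p, of i j] by simp
  then show "p i \<noteq> p j" using gdist_self p \<open>i \<in> {..k}\<close> by (auto simp: geodesic_def)
qed auto

lemma geodesic_edges_inj:
  assumes p: "geodesic p k" shows "inj_on (\<lambda>t. {p t, p (Suc t)}) {..<k}"
proof (rule inj_onI)
  fix s t assume "s \<in> {..<k}" "t \<in> {..<k}" "{p s, p (Suc s)} = {p t, p (Suc t)}"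
  then show "s = t"
    using inj_on_eq_iff[OF geodesic_inj[OF p]] by (auto simp: doubleton_eq_iff)
qed

lemma finite_sep: "finite (sep V E x y)"
  using finite_edges[OF simple] by (simp add: sep_def)

lemma excess_nonneg:
  assumes "x \<in> V" "y \<in> V" shows "excess V E x y \<ge> 0"
proof -
  obtain p where p: "geodesic p (d x y)" "p 0 = x" "p (d x y) = y"
    using geodesic_exists assms by blast
  have "(\<lambda>t. {p t, p (Suc t)}) ` {..<d x y} \<subseteq> sep V E x y"
    using geodesic_edge_sep[OF p(1)] p by auto
  then have "card ((\<lambda>t. {p t, p (Suc t)}) ` {..<d x y}) \<le> card (sep V E x y)"
    using finite_sep card_mono by blast
  then show ?thesis using card_image[OF geodesic_edges_inj[OF p(1)]] by (simp add: excess_def)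
qed

end

subsection \<open>Isometric cycles\<close>

context fin_conn_graph
begin

lemma gdist_1_edge: "u \<in> V \<Longrightarrow> v \<in> V \<Longrightarrow> d u v = 1 \<Longrightarrow> {u, v} \<in> E"
  using gdist_walk[of u v] by (auto simp: walk_between_Suc walk_between_0)

text \<open>Both \<open>u\<close> and \<open>v\<close> are last but one on geodesics from
  \<open>x\<close> to \<open>y\<close>, so geodesics from \<open>x\<close> arrive at
  \<open>y\<close> through different last edges, which a tree does not allow.\<close>

definition branching :: "'a \<Rightarrow> 'a \<Rightarrow> bool" where
  "branching x y \<longleftrightarrow> x \<in> V \<and> y \<in> V \<and>
     (\<exists>u v. u \<noteq> v \<and> {u, y} \<in> E \<and> {v, y} \<in> E \<and> d x u < d x y \<and> d x v < d x y)"

text \<open>The cycle is a function of period \<open>2 * k\<close> on all naturals, which avoids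
  modular indices. Arcs of at most \<open>k\<close> steps reach all pairs, since of the two arcs
  between two vertices one is that short.\<close>

definition isometric_cycle :: "(nat \<Rightarrow> 'a) \<Rightarrow> nat \<Rightarrow> bool" where
  "isometric_cycle c k \<longleftrightarrow> 2 \<le> k \<and> (\<forall>i. c i \<in> V) \<and> (\<forall>i. c (i + 2 * k) = c i) \<and>
     (\<forall>i. \<forall>j\<le>k. d (c i) (c (i + j)) = j)"

end

section \<open>Parity of distances and a shortest branching pair in bipartite graphs\<close>

locale bip_conn_graph = fin_conn_graph +
  assumes bip: "bipartite V E"
begin

text \<open>The parity of the length of a walk from \<open>x\<close> is determined by the side on
  which it ends, and the ends of an edge lie on different sides. With \<open>gdist_edge_le\<close>,
  distances from \<open>x\<close> thus change by exactly one along an edge.\<close>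

lemma gdist_edge_neq:
  assumes e: "{u, v} \<in> E" and x: "x \<in> V"
  shows "d x u \<noteq> d x v"
proof -
  obtain A B where AB: "A \<inter> B = {}" "\<forall>e\<in>E. \<exists>a\<in>A. \<exists>b\<in>B. e = {a, b}"
    using bip unfolding bipartite_def by (elim exE conjE)
  have edge: "u \<in> A \<longleftrightarrow> v \<notin> A" if "{u, v} \<in> E" for u v
    using AB(1) bspec[OF AB(2) that] by (auto simp: doubleton_eq_iff)
  have par: "even k \<longleftrightarrow> (x \<in> A \<longleftrightarrow> y \<in> A)" if "walk_between V E x y k" for y k
    using that
  proof (induction k arbitrary: y)
    case 0
    then show ?case by (simp add: walk_between_0)
  next
    case (Suc k)
    then show ?case using edge by (auto simp: walk_between_Suc)
  qed
  have "even (d x u) \<noteq> even (d x v)"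
    using par[OF gdist_walk[OF x]] edgeD[OF e] edge[OF e] by simp
  then show ?thesis by metis
qed

text \<open>Send each edge to its end farther from a root \<open>r\<close>, which is well defined by
  \<open>gdist_edge_neq\<close>. Without branching pairs this map is injective, and it misses
  \<open>r\<close>, so there would be fewer edges than vertices.\<close>

lemma branching_exists:
  assumes m: "card E \<ge> card V"
  shows "\<exists>x y. branching x y"
proof (rule ccontr)
  assume nb: "\<not> ?thesis"
  obtain r where r: "r \<in> V" using conn by (auto simp: connected_graph_def)
  define far where "far e = (THE v. \<exists>u. e = {u, v} \<and> d r u < d r v)" for e
  have far: "\<exists>u. e = {u, far e} \<and> d r u < d r (far e)" if "e \<in> E" for e
  proof -
    obtain a b where ab: "e = {a, b}" using simple_graph_edgeE[OF simple \<open>e \<in> E\<close>] by blast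
    then have "d r a \<noteq> d r b" using gdist_edge_neq that r by simp
    then have "\<exists>!v. \<exists>u. e = {u, v} \<and> d r u < d r v"
      unfolding ab doubleton_eq_iff by (metis linorder_neqE_nat not_less_iff_gr_or_eq)
    then show ?thesis unfolding far_def by (rule theI')
  qed
  have "inj_on far E"
  proof (rule inj_onI)
    fix e f assume ef: "e \<in> E" "f \<in> E" "far e = far f"
    define v where "v = far e"
    obtain a where a: "e = {a, v}" "d r a < d r v" using far[OF ef(1)] v_def by blast
    obtain b where b: "f = {b, v}" "d r b < d r v" using far[OF ef(2)] ef(3) v_def by auto
    have "v \<in> V" using edgeD(2) a ef by blast
    moreover have "\<not> branching r v" using nb by blast
    ultimately have "a = b" unfolding branching_def using a b ef r by blast
    then show "e = f" using a b by simp
  qed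
  moreover have "far ` E \<subseteq> V - {r}"
  proof
    fix v assume "v \<in> far ` E"
    then obtain e where e: "e \<in> E" "v = far e" by blast
    then obtain u where u: "e = {u, v}" "d r u < d r v" using far by blast
    then have "v \<in> V" using edgeD(2) e by blast
    then show "v \<in> V - {r}" using u gdist_self by auto
  qed
  ultimately have "card E \<le> card (V - {r})" using finite_V by (intro card_inj_on_le) auto
  moreover have "card (V - {r}) < card V" using r finite_V by (intro psubset_card_mono) auto
  ultimately show False using m by simp
qed

text \<open>If the geodesics shared their second vertex, dropping the first one would leave the
  branching pair \<open>(p 1, p k)\<close> at distance \<open>k - 1\<close>.\<close>

lemma geodesic_pair_second_neq:
  assumes p: "geodesic p k" and q: "geodesic q k"
    and ends: "p k = q k" and neq: "p (k - 1) \<noteq> q (k - 1)"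
    and min: "\<And>x y. branching x y \<Longrightarrow> k \<le> d x y" and k: "k \<ge> 2"
  shows "p 1 \<noteq> q 1"
proof
  assume eq: "p 1 = q 1"
  have "d (p 1) (p k) = k - 1" "d (p 1) (p (k - 1)) = k - 1 - 1"
    using geodesic_dist[OF p, of 1 k] geodesic_dist[OF p, of 1 "k - 1"] k by auto
  moreover have "d (p 1) (q (k - 1)) = k - 1 - 1"
    using geodesic_dist[OF q, of 1 "k - 1"] k eq by auto
  moreover have "{p (k - 1), p k} \<in> E" "{q (k - 1), p k} \<in> E"
  proof -
    have k1: "k - 1 < k" "Suc (k - 1) = k" using k by auto
    show "{p (k - 1), p k} \<in> E" "{q (k - 1), p k} \<in> E"
      using p q k1 ends unfolding geodesic_def by metis+
  qed
  moreover have "p 1 \<in> V" "p k \<in> V" using p k by (auto simp: geodesic_def)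
  ultimately have "branching (p 1) (p k)"
    unfolding branching_def using neq k by (intro conjI exI[of _ "p (k - 1)"] exI[of _ "q (k - 1)"]) auto
  then show False using min \<open>d (p 1) (p k) = k - 1\<close> k by fastforce
qed

text \<open>Two geodesics with common ends but different last edges, whose length is least possible,
  form an isometric cycle: a shortcut between them would create a shorter such pair.\<close>

lemma geodesic_pair_dist:
  assumes p: "geodesic p k" and q: "geodesic q k"
    and start: "p 0 = q 0" and neq: "p 1 \<noteq> q 1"
    and min: "\<And>x y. branching x y \<Longrightarrow> k \<le> d x y" and ij: "i + j \<le> k"
  shows "d (p i) (q j) = i + j"
  using ij
proof (induction "i + j" arbitrary: i j rule: less_induct)
  case less
  consider "i = 0" | "j = 0" | i' where "i = Suc i'" "j \<ge> 1" using not0_implies_Suc by auto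
  then show ?case
  proof cases
    case 1
    then show ?thesis using geodesic_dist[OF q, of 0 j] start less by simp
  next
    case 2
    then show ?thesis using geodesic_dist[OF p, of 0 i] start less by (simp add: gdist_sym)
  next
    case 3
    have V: "p i \<in> V" "p i' \<in> V" "q j \<in> V" using p q less 3 by (auto simp: geodesic_def)
    have e: "{p i', p i} \<in> E" using p less 3 by (auto simp: geodesic_def)
    have d': "d (q j) (p i') = i' + j" using less.hyps[of i' j] less.prems 3 by (simp add: gdist_sym)
    show ?thesis
    proof (rule ccontr)
      \<comment> \<open>By parity, the step from \<open>p i'\<close> to \<open>p i\<close> must then
        approach \<open>q j\<close> instead of receding from it.\<close>
      assume "d (p i) (q j) \<noteq> i + j"
      then have "d (q j) (p i) \<noteq> Suc (d (q j) (p i'))"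
        using d' 3 by (simp add: gdist_sym)
      then have lt: "d (q j) (p i) < d (q j) (p i')"
        using gdist_edge_le[OF e V(3)] gdist_edge_neq[OF e V(3)] by simp
      \<comment> \<open>Besides \<open>p i\<close>, the neighbour of \<open>p i'\<close> on the
        other side is closer to \<open>q j\<close> as well: the preceding vertex of
        \<open>p\<close>, or \<open>q 1\<close> if \<open>p i'\<close> is the common start. So
        \<open>(q j, p i')\<close> branches, at distance \<open>i' + j < k\<close>.\<close>
      have "\<exists>v. v \<noteq> p i \<and> {v, p i'} \<in> E \<and> d (q j) v < d (q j) (p i')"
      proof (cases i')
        case 0
        have "{q 1, p i'} \<in> E" using q less.prems 3 0 start by (auto simp: geodesic_def insert_commute)
        moreover have "d (q j) (q 1) = j - 1"
          using geodesic_dist[OF q, of 1 j] less.prems 3 by (simp add: gdist_sym)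
        ultimately show ?thesis using 3 0 d' neq by (intro exI[of _ "q 1"]) auto
      next
        case (Suc i'')
        have "{p i'', p i'} \<in> E" using p less.prems 3 Suc by (auto simp: geodesic_def)
        moreover have "d (q j) (p i'') = i'' + j"
          using less.hyps[of i'' j] less.prems 3 Suc by (simp add: gdist_sym)
        moreover have "p i'' \<noteq> p i"
          using inj_on_eq_iff[OF geodesic_inj[OF p], of i'' i] less.prems 3 Suc by simp
        ultimately show ?thesis using Suc d' by (intro exI[of _ "p i''"]) auto
      qed
      then obtain v where "v \<noteq> p i" "{v, p i'} \<in> E" "d (q j) v < d (q j) (p i')" by blast
      then have "branching (q j) (p i')"
        unfolding branching_def using V e lt
        by (intro conjI exI[of _ v] exI[of _ "p i"]) (auto simp: insert_commute)
      then show False using min d' less.prems 3 by fastforce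
    qed
  qed
qed

text \<open>Take a branching pair \<open>(x, y)\<close> at the least distance \<open>k\<close>, walk
  along one geodesic from \<open>x\<close> to \<open>y\<close> and return along one with a different
  last edge.\<close>

lemma isometric_cycle_exists:
  assumes "card E \<ge> card V"
  shows "\<exists>c k. isometric_cycle c k"
proof -
  define P where "P k \<longleftrightarrow> (\<exists>x y. branching x y \<and> d x y = k)" for k
  define k where "k = (LEAST k. P k)"
  have "\<exists>k. P k" using branching_exists[OF assms] by (auto simp: P_def)
  then have "P k" unfolding k_def by (rule LeastI_ex)
  then obtain x y where xy: "branching x y" "d x y = k" by (auto simp: P_def)
  have min: "k \<le> d x y" if "branching x y" for x y
    unfolding k_def using that by (intro Least_le) (auto simp: P_def)
  obtain u v where uv: "u \<noteq> v" "{u, y} \<in> E" "{v, y} \<in> E" "d x u < k" "d x v < k" and V: "x \<in> V" "y \<in> V"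
    using xy by (auto simp: branching_def)
  have duv: "k = Suc (d x u)" "k = Suc (d x v)"
    using gdist_edge_le[OF uv(2) V(1)] gdist_edge_le[OF uv(3) V(1)] uv xy by auto
  have ex: "\<exists>p. geodesic p k \<and> p 0 = x \<and> p k = y \<and> p (k - 1) = w"
    if w: "{w, y} \<in> E" "k = Suc (d x w)" for w
  proof -
    obtain p where p: "geodesic p (d x w)" "p 0 = x" "p (d x w) = w"
      using geodesic_exists[OF V(1) edgeD(1)[OF w(1)]] by blast
    then have "geodesic (p(k := y)) k" using geodesic_snoc[of p "d x w" y] w xy by simp
    then show ?thesis using p w by (intro exI[of _ "p(k := y)"]) simp
  qed
  obtain p where p: "geodesic p k" "p 0 = x" "p k = y" "p (k - 1) = u" using ex[OF uv(2) duv(1)] by blast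
  obtain q where q: "geodesic q k" "q 0 = x" "q k = y" "q (k - 1) = v" using ex[OF uv(3) duv(2)] by blast
  \<comment> \<open>For \<open>k \<le> 1\<close> both predecessors of \<open>y\<close> would be the
    common start \<open>x\<close>.\<close>
  have k: "k \<ge> 2"
  proof (rule ccontr)
    assume "\<not> ?thesis"
    then have "k - 1 = 0" by simp
    then show False using p q uv by metis
  qed
  have neq1: "p 1 \<noteq> q 1"
    using geodesic_pair_second_neq[OF p(1) q(1) _ _ min k] p q uv by simp
  have low: "d (p i) (q j) = i + j" if "i + j \<le> k" for i j
    using geodesic_pair_dist[OF p(1) q(1) _ neq1 min that] p q by simp
  \<comment> \<open>Reversal exchanges the roles of \<open>x\<close> and \<open>y\<close>; the
    condition on the first edges is now met because the last edges differ.\<close>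
  have high: "d (p i) (q j) = 2 * k - i - j" if "k \<le> i + j" "i \<le> k" "j \<le> k" for i j
    using geodesic_pair_dist[OF geodesic_rev[OF p(1)] geodesic_rev[OF q(1)] _ _ min,
        of "k - i" "k - j"] p q uv that by simp
  \<comment> \<open>Positions \<open>0\<close> to \<open>k\<close> run along \<open>p\<close> from
    \<open>x\<close> to \<open>y\<close>, the later ones back along \<open>q\<close>; the reduction
    modulo \<open>2 * k\<close> makes \<open>c\<close> periodic.\<close>
  define c where "c i = (if i mod (2 * k) \<le> k then p (i mod (2 * k)) else q (2 * k - i mod (2 * k)))" for i
  have cV: "c i \<in> V" for i using p q by (auto simp: c_def geodesic_def)
  have "d (c i) (c (i + j)) = j" if j: "j \<le> k" for i j
  proof -
    define m where "m = i mod (2 * k)"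
    have m: "m < 2 * k" using k by (simp add: m_def)
    have mj: "(i + j) mod (2 * k) = (if m + j < 2 * k then m + j else m + j - 2 * k)"
    proof -
      have "(i + j) mod (2 * k) = (m + j) mod (2 * k)" by (simp add: m_def mod_add_left_eq)
      also have "\<dots> = (if m + j < 2 * k then m + j else m + j - 2 * k)"
        using m j by (simp add: mod_if)
      finally show ?thesis .
    qed
    define l where "l = (if m + j < 2 * k then m + j else m + j - 2 * k)"
    have cij: "c (i + j) = (if l \<le> k then p l else q (2 * k - l))"
      unfolding c_def mj l_def ..
    have ci: "c i = (if m \<le> k then p m else q (2 * k - m))" by (simp add: c_def m_def)
    \<comment> \<open>The arc from position \<open>m\<close> to \<open>m + j\<close> stays on
      \<open>p\<close>, passes beyond \<open>y\<close>, is the whole way from \<open>y\<close> back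
      to \<open>x\<close>, stays on \<open>q\<close>, or starts on \<open>q\<close> and reaches or
      passes \<open>x\<close>.\<close>
    consider "m + j \<le> k" | "m \<le> k" "k < m + j" "m + j < 2 * k" | "m \<le> k" "m + j = 2 * k"
      | "k < m" "m + j < 2 * k" | "k < m" "m + j \<ge> 2 * k" using m j by linarith
    then show ?thesis
    proof cases
      case 1
      then show ?thesis using geodesic_dist[OF p(1), of m "m + j"] k by (simp add: ci cij l_def)
    next
      case 2
      then show ?thesis using high[of m "2 * k - (m + j)"] j by (simp add: ci cij l_def)
    next
      case 3
      then have "m = k" "j = k" using j by auto
      then show ?thesis
        unfolding ci cij l_def using geodesic_dist[OF p(1), of 0 k] k by (simp add: gdist_sym)
    next
      case 4
      then show ?thesis using geodesic_dist[OF q(1), of "2 * k - (m + j)" "2 * k - m"] m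
        by (simp add: ci cij l_def gdist_sym)
    next
      case 5
      then have "m + j - 2 * k \<le> k" using m j by simp
      then show ?thesis using low[of "m + j - 2 * k" "2 * k - m"] 5 m j
        by (simp add: ci cij l_def gdist_sym)
    qed
  qed
  moreover have "c (i + 2 * k) = c i" for i by (simp add: c_def)
  ultimately have "isometric_cycle c k" using k cV by (simp add: isometric_cycle_def)
  then show ?thesis by blast
qed

end

subsection \<open>The lower bound\<close>

lemma sum_lessThan_add:
  fixes f :: "nat \<Rightarrow> 'b::comm_monoid_add"
  shows "sum f {..<k + l} = sum f {..<k} + (\<Sum>j<l. f (k + j))"
  by (induction l) (simp_all add: add.assoc)

section \<open>Vertices and edges of an isometric cycle\<close>

context fin_conn_graph
begin

text \<open>If the arc from \<open>a\<close> to \<open>b\<close> is longer than \<open>k\<close>,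
  the complementary arc from \<open>b\<close> to \<open>a + 2 * k\<close> is short and of positive
  length.\<close>

lemma isometric_cycle_neq:
  assumes c: "isometric_cycle c k" and ab: "a < b" "b < a + 2 * k"
  shows "c a \<noteq> c b"
proof (cases "b - a \<le> k")
  case True
  then have "d (c a) (c (a + (b - a))) = b - a" using c by (simp add: isometric_cycle_def)
  moreover have "c a \<in> V" using c by (simp add: isometric_cycle_def)
  ultimately show ?thesis using ab gdist_self by fastforce
next
  case False
  then have "a + 2 * k - b \<le> k" using ab by simp
  then have "d (c b) (c (b + (a + 2 * k - b))) = a + 2 * k - b"
    using c unfolding isometric_cycle_def by blast
  moreover have "c (b + (a + 2 * k - b)) = c a" "c b \<in> V" using c ab by (simp_all add: isometric_cycle_def)
  ultimately show ?thesis using ab gdist_self by fastforce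
qed

lemma isometric_cycle_inj:
  assumes c: "isometric_cycle c k"
  shows "inj_on (\<lambda>j. c (i + j)) {..<2 * k}"
  by (rule linorder_inj_onI) (use isometric_cycle_neq[OF c] in auto)

text \<open>Lets a sum over the cycle start at any chosen vertex. For \<open>i = 0\<close>
  periodicity gives the equality; any other window of this length is injective, so it fills the
  range by cardinality.\<close>

lemma isometric_cycle_range:
  assumes c: "isometric_cycle c k"
  shows "(\<lambda>j. c (i + j)) ` {..<2 * k} = range c" "card (range c) = 2 * k"
proof -
  have k: "2 * k > 0" using c by (simp add: isometric_cycle_def)
  have per: "c (i + 2 * k * m) = c i" for i m
  proof (induction m)
    case (Suc m)
    have "c (i + 2 * k * m + 2 * k) = c (i + 2 * k * m)" using c by (simp only: isometric_cycle_def)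
    then show ?case using Suc by (simp add: algebra_simps)
  qed simp
  have "range c \<subseteq> (\<lambda>j. c (0 + j)) ` {..<2 * k}"
  proof
    fix x assume "x \<in> range c"
    then obtain j where "x = c j" by blast
    then have "x = c (j mod (2 * k))" using per[of "j mod (2 * k)" "j div (2 * k)"] by simp
    then show "x \<in> (\<lambda>j. c (0 + j)) ` {..<2 * k}" using k by auto
  qed
  then have r0: "range c = (\<lambda>j. c (0 + j)) ` {..<2 * k}" by auto
  then show card: "card (range c) = 2 * k"
    using card_image[OF isometric_cycle_inj[OF c, of 0]] by simp
  have fin: "finite (range c)" using r0 by simp
  show "(\<lambda>j. c (i + j)) ` {..<2 * k} = range c"
    using card_image[OF isometric_cycle_inj[OF c, of i]] card fin by (intro card_subset_eq) auto
qed

lemma isometric_cycle_edge: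
  assumes c: "isometric_cycle c k" shows "{c i, c (Suc i)} \<in> E"
proof -
  have "\<forall>i. \<forall>j\<le>k. d (c i) (c (i + j)) = j" "1 \<le> k" "c i \<in> V" "c (Suc i) \<in> V"
    using c by (auto simp: isometric_cycle_def)
  then have "d (c i) (c (i + 1)) = 1" by blast
  then show ?thesis using gdist_1_edge[OF \<open>c i \<in> V\<close> \<open>c (Suc i) \<in> V\<close>] by simp
qed

lemma isometric_cycle_edges_inj:
  assumes c: "isometric_cycle c k"
  shows "inj_on (\<lambda>j. {c (i + j), c (Suc (i + j))}) {..<2 * k}"
proof (rule linorder_inj_onI)
  fix a b assume ab: "a < b" "a \<in> {..<2 * k}" "b \<in> {..<2 * k}"
  have k: "k \<ge> 2" using c by (simp add: isometric_cycle_def)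
  have "c (i + a) \<noteq> c (i + b)" using ab by (intro isometric_cycle_neq[OF c]) auto
  \<comment> \<open>This excludes that the two edges agree crosswise. The second inequality fails
    only for \<open>b = Suc a\<close>, the first only for \<open>a = 0\<close> and
    \<open>b = 2 * k - 1\<close>; as \<open>k \<ge> 2\<close>, they never fail together.\<close>
  moreover have "c (i + a) \<noteq> c (Suc (i + b)) \<or> c (Suc (i + a)) \<noteq> c (i + b)"
  proof (cases "b = Suc a")
    case True
    then show ?thesis using isometric_cycle_neq[OF c, of "i + a" "Suc (i + b)"] k by simp
  next
    case False
    then show ?thesis using isometric_cycle_neq[OF c, of "Suc (i + a)" "i + b"] ab by simp
  qed
  ultimately show "{c (i + a), c (Suc (i + a))} \<noteq> {c (i + b), c (Suc (i + b))}"
    by (auto simp: doubleton_eq_iff)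
qed auto

end

context bip_conn_graph
begin

text \<open>Going once around the cycle from \<open>c i\<close>, an edge separates \<open>w\<close> from \<open>c i\<close> iff the distance
  to \<open>w\<close> decreases along it on the first half, or increases along it on the second half. The first
  \<open>r\<close> edges of a geodesic from \<open>w\<close> to \<open>c i\<close> are further separating edges, not on the cycle.\<close>

lemma card_sep_cycle_ge:
  assumes c: "isometric_cycle c k" and w: "w \<in> V" and r: "\<And>j. r \<le> d w (c j)"
  shows "int r + int k + int (d w (c i)) - int (d w (c (i + k))) \<le> int (card (sep V E w (c i)))"
proof -
  define f where "f j = d w (c j)" for j
  have cV: "c j \<in> V" and cper: "c (j + 2 * k) = c j"
    and cd: "l \<le> k \<Longrightarrow> d (c j) (c (j + l)) = l" for j l
    using c by (auto simp: isometric_cycle_def)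
  obtain p where p: "geodesic p (f i)" "p 0 = w" "p (f i) = c i"
    using geodesic_exists[OF w cV[of i]] unfolding f_def by blast
  define A where "A = (\<lambda>t. {p t, p (Suc t)}) ` {..<r}"
  have rf: "r \<le> f i" using r by (simp add: f_def)
  have A: "A \<subseteq> sep V E w (c i)"
    unfolding A_def using geodesic_edge_sep[OF p(1)] p rf by auto
  have cardA: "card A = r"
    unfolding A_def using inj_on_subset[OF geodesic_edges_inj[OF p(1)]] rf by (subst card_image) auto
  define J where "J = {j. j < 2 * k \<and> (if j < k then f (Suc (i + j)) < f (i + j) else f (i + j) < f (Suc (i + j)))}"
  define B where "B = (\<lambda>j. {c (i + j), c (Suc (i + j))}) ` J"
  have J: "J \<subseteq> {..<2 * k}" by (auto simp: J_def)
  have cardB: "card B = card J"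
    unfolding B_def using inj_on_subset[OF isometric_cycle_edges_inj[OF c] J] by (rule card_image)
  \<comment> \<open>Each edge of \<open>A\<close> has an end \<open>p t\<close> at distance
    \<open>t < r\<close> from \<open>w\<close>, nearer than any vertex of the cycle.\<close>
  have "A \<inter> B = {}"
  proof (rule ccontr)
    assume "A \<inter> B \<noteq> {}"
    then obtain t where t: "t < r" "{p t, p (Suc t)} \<in> B" by (auto simp: A_def)
    then obtain j where "p t = c j" by (auto simp: B_def doubleton_eq_iff)
    moreover have "d w (p t) = t" using geodesic_dist[OF p(1), of 0 t] p t rf by simp
    ultimately show False using r[of j] t by simp
  qed
  moreover have "B \<subseteq> sep V E w (c i)"
  proof
    fix e assume "e \<in> B"
    then obtain j where j: "j \<in> J" "e = {c (i + j), c (Suc (i + j))}" by (auto simp: B_def)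
    have E: "e \<in> E" using isometric_cycle_edge[OF c] j by simp
    show "e \<in> sep V E w (c i)"
    proof (cases "j < k")
      case True
      then have "d (c (i + j)) (c i) = j" "d (c (Suc (i + j))) (c i) = Suc j"
        using cd[of j i] cd[of "Suc j" i] by (simp_all add: gdist_sym)
      then show ?thesis using j True E w cV
        by (simp add: sep_doubleton_iff closer_def J_def f_def gdist_sym[of V E _ w])
    next
      case False
      then have jk: "j < 2 * k" "2 * k - j \<le> k" using j by (auto simp: J_def)
      then have "d (c (i + j)) (c i) = 2 * k - j" "d (c (Suc (i + j))) (c i) = 2 * k - Suc j"
        using cd[of "2 * k - j" "i + j"] cd[of "2 * k - Suc j" "Suc (i + j)"] cper[of i]
        by simp_all
      then show ?thesis using j False E w cV jk
        by (simp add: sep_doubleton_iff closer_def J_def f_def gdist_sym[of V E _ w])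
    qed
  qed
  ultimately have "card (A \<union> B) = r + card J" "card (A \<union> B) \<le> card (sep V E w (c i))"
    using A cardA cardB finite_subset[OF _ finite_sep] card_mono[OF finite_sep, of "A \<union> B"]
    by (simp_all add: card_Un_disjoint)
  \<comment> \<open>By \<open>step\<close>, \<open>f\<close> changes by plus or minus one along each
    edge of the cycle. Twice the indicator of \<open>J\<close> is one minus this change on the first
    half and one plus it on the second, so the doubled count telescopes.\<close>
  moreover have "int (card J) = int k + int (f i) - int (f (i + k))"
  proof -
    have step: "f (Suc j) = Suc (f j) \<or> f j = Suc (f (Suc j))" for j
      using gdist_edge_le[OF isometric_cycle_edge[OF c] w, of j] gdist_edge_neq[OF isometric_cycle_edge[OF c] w, of j]
        gdist_edge_le[OF _ w, of "c (Suc j)" "c j"] isometric_cycle_edge[OF c, of j]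
      by (auto simp: f_def insert_commute)
    have "{..<k + k} \<inter> J = J" using J by auto
    then have "2 * int (card J) = (\<Sum>j<k + k. 2 * of_bool (j \<in> J))"
      by (simp flip: sum_distrib_left)
    also have "\<dots> = (\<Sum>j<k. 2 * of_bool (j \<in> J)) + (\<Sum>j<k. 2 * of_bool (k + j \<in> J))"
      by (rule sum_lessThan_add)
    also have "(\<Sum>j<k. 2 * of_bool (j \<in> J)) = (\<Sum>j<k. 1 - (int (f (i + Suc j)) - int (f (i + j))))"
    proof (intro sum.cong refl)
      fix j assume "j \<in> {..<k}"
      then show "2 * of_bool (j \<in> J) = 1 - (int (f (i + Suc j)) - int (f (i + j)))"
        using step[of "i + j"] by (auto simp: J_def)
    qed
    also have "\<dots> = int k - (int (f (i + k)) - int (f i))"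
      using sum_lessThan_telescope[of "\<lambda>j. int (f (i + j))" k] by (simp add: sum_subtractf)
    also have "(\<Sum>j<k. 2 * of_bool (k + j \<in> J))
        = (\<Sum>j<k. 1 + (int (f (i + k + Suc j)) - int (f (i + k + j))))"
    proof (intro sum.cong refl)
      fix j assume "j \<in> {..<k}"
      then show "2 * of_bool (k + j \<in> J) = 1 + (int (f (i + k + Suc j)) - int (f (i + k + j)))"
        using step[of "i + k + j"] by (auto simp: J_def add.assoc)
    qed
    also have "\<dots> = int k + (int (f (i + k + k)) - int (f (i + k)))"
      using sum_lessThan_telescope[of "\<lambda>j. int (f (i + k + j))" k] by (simp add: sum.distrib)
    also have "f (i + k + k) = f i" using cper[of i] by (simp add: f_def mult_2 add.assoc)
    finally show ?thesis by simp
  qed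
  ultimately show ?thesis by (simp add: f_def)
qed

text \<open>Let \<open>c i\<close> be nearest to \<open>w\<close>. The antipodal vertices
  \<open>c (i + j)\<close> and \<open>c (i + k + j)\<close> have excesses with \<open>w\<close> of
  at least \<open>j\<close> and \<open>k - j\<close>; so each of the \<open>k\<close> antipodal
  pairs contributes at least \<open>k\<close>.\<close>

lemma sum_excess_cycle_ge:
  assumes c: "isometric_cycle c k" and w: "w \<in> V"
  shows "int (k * k) \<le> (\<Sum>x\<in>range c. excess V E w x)"
proof -
  have cV: "c j \<in> V" and cper: "c (j + 2 * k) = c j"
    and cd: "l \<le> k \<Longrightarrow> d (c j) (c (j + l)) = l" for j l
    using c by (auto simp: isometric_cycle_def)
  obtain i where i: "d w (c i) \<le> d w (c j)" for j
    using ex_has_least_nat[of "\<lambda>_. True" 0 "\<lambda>j. d w (c j)"] by auto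
  have ge: "int (d w (c i)) + int k - int (d w (c (j + k))) \<le> excess V E w (c j)" for j
    using card_sep_cycle_ge[OF c w i, of j] by (simp add: excess_def)
  have "(\<Sum>x\<in>range c. excess V E w x) = (\<Sum>j<k + k. excess V E w (c (i + j)))"
    using sum.reindex[OF isometric_cycle_inj[OF c, of i]] isometric_cycle_range(1)[OF c, of i]
    by (simp add: mult_2)
  also have "\<dots> = (\<Sum>j<k. excess V E w (c (i + j)) + excess V E w (c (i + k + j)))"
    by (simp add: sum_lessThan_add sum.distrib add.assoc)
  also have "\<dots> \<ge> (\<Sum>j<k. int k)"
  proof (rule sum_mono)
    fix j assume "j \<in> {..<k}"
    then have j: "j < k" by simp
    \<comment> \<open>The detour goes through \<open>c i\<close>, which lies \<open>k - j\<close>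
      steps ahead of \<open>c (i + j + k)\<close>, at index \<open>i + 2 * k\<close>.\<close>
    have "d w (c (i + j + k)) \<le> d w (c (i + j + k + (k - j))) + d (c (i + j + k + (k - j))) (c (i + j + k))"
      using gdist_triangle w cV by blast
    also have "d (c (i + j + k + (k - j))) (c (i + j + k)) = k - j"
      using cd[of "k - j" "i + j + k"] j by (simp add: gdist_sym)
    also have "i + j + k + (k - j) = i + 2 * k" using j by simp
    finally have "d w (c (i + j + k)) \<le> d w (c i) + (k - j)" by (simp add: cper)
    then have "int j \<le> excess V E w (c (i + j))" using ge[of "i + j"] j by simp
    moreover have "d w (c (i + j)) \<le> d w (c i) + j"
      using gdist_triangle[OF w cV[of i] cV[of "i + j"]] cd[of j i] j by simp
    moreover have "i + k + j + k = i + j + 2 * k" by simp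
    then have "c (i + k + j + k) = c (i + j)" by (simp only: cper)
    ultimately show "int k \<le> excess V E w (c (i + j)) + excess V E w (c (i + k + j))"
      using ge[of "i + k + j"] by simp
  qed
  finally show ?thesis by simp
qed

text \<open>The sum over all ordered pairs is split by the second vertex. Each row over the cycle
  \<open>C\<close> gives \<open>k * k\<close>; by symmetry, so does each column of a vertex off
  \<open>C\<close> when restricted to first vertices on \<open>C\<close>. Pairs with both vertices
  off \<open>C\<close> are only bounded by \<open>0\<close>.\<close>

lemma szeged_wiener_ge:
  assumes m: "card E \<ge> card V"
  shows "int (szeged_index V E) - int (wiener_index V E) \<ge> 4 * int (card V) - 8"
proof -
  obtain c k where c: "isometric_cycle c k" using isometric_cycle_exists[OF m] by blast
  define C where "C = range c"
  have CV: "C \<subseteq> V" and k: "k \<ge> 2" using c by (auto simp: C_def isometric_cycle_def)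
  have finC: "finite C" using CV finite_V finite_subset by blast
  have cardC: "card C = 2 * k" using isometric_cycle_range(2)[OF c] by (simp add: C_def)
  have nk: "2 * k \<le> card V" using card_mono[OF finite_V CV] cardC by simp
  have row: "int (k * k) \<le> (\<Sum>y\<in>C. excess V E x y)" if "x \<in> V" for x
    using sum_excess_cycle_ge[OF c that] by (simp add: C_def)
  have 1: "(\<Sum>x\<in>V. int (k * k)) \<le> (\<Sum>x\<in>V. \<Sum>y\<in>C. excess V E x y)"
    using row by (rule sum_mono)
  have "(\<Sum>y\<in>V - C. int (k * k)) \<le> (\<Sum>y\<in>V - C. \<Sum>x\<in>C. excess V E x y)"
    using row by (intro sum_mono) (simp add: excess_sym)
  also have "\<dots> = (\<Sum>x\<in>C. \<Sum>y\<in>V - C. excess V E x y)" by (rule sum.swap)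
  also have "\<dots> \<le> (\<Sum>x\<in>V. \<Sum>y\<in>V - C. excess V E x y)"
    using CV finite_V by (intro sum_mono2 sum_nonneg excess_nonneg) auto
  finally have 2: "(\<Sum>y\<in>V - C. int (k * k)) \<le> (\<Sum>x\<in>V. \<Sum>y\<in>V - C. excess V E x y)" .
  have "(\<Sum>x\<in>V. \<Sum>y\<in>V. excess V E x y)
      = (\<Sum>x\<in>V. (\<Sum>y\<in>V - C. excess V E x y) + (\<Sum>y\<in>C. excess V E x y))"
    by (intro sum.cong refl sum.subset_diff[OF CV finite_V])
  then have "2 * (int (szeged_index V E) - int (wiener_index V E))
      \<ge> int (card V) * int (k * k) + int (card V - 2 * k) * int (k * k)"
    using 1 2 sum_excess card_Diff_subset[OF finC CV] cardC by (simp add: sum.distrib)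
  moreover obtain m where m: "card V = 2 * k + m" using nk le_Suc_ex by blast
  moreover obtain t where t: "k = 2 + t" using k le_Suc_ex by blast
  \<comment> \<open>With \<open>card V = 2 * k + m\<close> and \<open>k = 2 + t\<close>, the surplus
    over the claimed bound is a polynomial with nonnegative coefficients; it vanishes for
    \<open>t = 0\<close>, the four-cycle.\<close>
  moreover have "int (card V) * int (k * k) + int (card V - 2 * k) * int (k * k)
      = 2 * (4 * int (card V) - 8) + 2 * int (4*t + 6*t*t + t*t*t + 4*t*m + t*t*m)"
    unfolding m t by (simp add: algebra_simps)
  ultimately have "2 * (4 * int (card V) - 8) \<le> 2 * (int (szeged_index V E) - int (wiener_index V E))"
    using of_nat_0_le_iff[of "4*t + 6*t*t + t*t*t + 4*t*m + t*t*m", where 'a=int] by linarith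
  then show ?thesis by simp
qed

end

subsection \<open>Pendant vertices and trees\<close>

lemma connected_graph_from_root:
  assumes x: "x \<in> V" and walks: "\<And>z. z \<in> V \<Longrightarrow> \<exists>k. walk_between V E x z k"
  shows "connected_graph V E"
  unfolding connected_graph_def
proof (intro conjI ballI)
  fix u v assume "u \<in> V" "v \<in> V"
  then obtain k l where "walk_between V E u x k" "walk_between V E x v l"
    using walks walk_between_sym by metis
  then show "\<exists>k. walk_between V E u v k" using walk_between_trans by metis
qed (use x in auto)

lemma excess_self: "x \<in> V \<Longrightarrow> excess V E x x = 0"
proof -
  assume "x \<in> V"
  then have "gdist V E x x = 0" using gdist_le[of V E x x 0] by (simp add: walk_between_0)
  moreover have "sep V E x x = {}" by (auto simp: sep_def closer_def)
  ultimately show ?thesis by (simp add: excess_def)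
qed

locale pendant = fin_conn_graph +
  fixes w y
  assumes w: "w \<notin> V" and y: "y \<in> V"
begin

abbreviation V' where "V' \<equiv> insert w V"
abbreviation E' where "E' \<equiv> insert {w, y} E"

lemma simple_pendant: "simple_graph V' E'"
  using simple w y by (auto simp: simple_graph_def card_2_iff)

text \<open>The old distance from \<open>x\<close>, extended to \<open>w\<close> by one more than
  its value at \<open>y\<close>, is a potential on the enlarged graph.\<close>

lemma pendant_walk_gdist:
  assumes x: "x \<in> V" and z: "z \<in> V'"
  shows "walk_between V' E' x z (if z = w then Suc (d x y) else d x z)"
    and "gdist V' E' x z = (if z = w then Suc (d x y) else d x z)"
proof -
  let ?g = "\<lambda>z. if z = w then Suc (d x y) else d x z"
  have x': "x \<in> V'" "?g x = 0" using x w gdist_self by auto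
  have lip: "?g v \<le> Suc (?g u)" if "{u, v} \<in> E'" for u v
    using that
  proof (rule insertE)
    assume "{u, v} = {w, y}"
    then show ?thesis using w y by (auto simp: doubleton_eq_iff)
  next
    assume e: "{u, v} \<in> E"
    then have "u \<noteq> w" "v \<noteq> w" using edgeD w by blast+
    then show ?thesis using gdist_edge_le[OF e x] by simp
  qed
  have desc: "\<exists>v\<in>V'. {v, z} \<in> E' \<and> ?g v < ?g z" if z: "z \<in> V'" "z \<noteq> x" for z
  proof (cases "z = w")
    case True
    then show ?thesis using y w by (intro bexI[of _ y]) (auto simp: insert_commute)
  next
    case False
    then obtain v where "v \<in> V" "{v, z} \<in> E" "d x z = Suc (d x v)"
      using gdist_pred[OF x, of z] z by blast
    then show ?thesis using w False by (intro bexI[of _ v]) auto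
  qed
  show "walk_between V' E' x z (?g z)" using potential_walk[of x V' ?g E', OF x' lip desc z] .
  show "gdist V' E' x z = ?g z" using gdist_eq_potential[of x V' ?g E', OF x' lip desc z] .
qed

lemma connected_pendant: "connected_graph V' E'"
proof (rule connected_graph_from_root[of y])
  show "\<exists>k. walk_between V' E' y z k" if "z \<in> V'" for z
    using pendant_walk_gdist(1)[OF y that] by blast
qed (use y in simp)

lemma gdist_pendant:
  assumes "x \<in> V"
  shows "z \<in> V \<Longrightarrow> gdist V' E' x z = d x z"
    and "gdist V' E' x w = Suc (d x y)" and "gdist V' E' w x = Suc (d x y)"
  using pendant_walk_gdist(2)[OF assms] w by (auto simp: gdist_sym[of V' E' w])

lemma gdist_pendant_self: "gdist V' E' w w = 0"
  using gdist_le[of V' E' w w 0] by (simp add: walk_between_0)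

text \<open>Old distances persist, so old edges separate as before; the new edge separates no old
  vertices, since they are all closer to \<open>y\<close> than to \<open>w\<close>.\<close>

lemma sep_pendant:
  assumes "x \<in> V" "z \<in> V"
  shows "sep V' E' x z = sep V E x z"
proof (rule set_eqI)
  fix e
  show "e \<in> sep V' E' x z \<longleftrightarrow> e \<in> sep V E x z"
  proof (cases "e \<in> E")
    case True
    then obtain u v where uv: "e = {u, v}" "u \<in> V" "v \<in> V" using simple_graph_edgeE[OF simple] by metis
    then show ?thesis using True assms by (simp add: sep_doubleton_iff closer_def gdist_pendant)
  next
    case False
    then have "e \<notin> sep V E x z" by (simp add: sep_def)
    moreover have "{w, y} \<notin> sep V' E' x z"
      using assms y
      by (simp add: sep_doubleton_iff closer_def gdist_pendant gdist_sym[of V E y x] gdist_sym[of V E y z])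
    moreover have "e \<in> sep V' E' x z \<Longrightarrow> e = {w, y}" using False by (simp add: sep_def)
    ultimately show ?thesis by blast
  qed
qed

text \<open>Distances from \<open>w\<close> to old vertices exceed those from \<open>y\<close> by
  one, so \<open>w\<close> and \<open>y\<close> lie on the same side of each old edge; the new edge
  separates \<open>w\<close> from all old vertices.\<close>

lemma sep_pendant_leaf:
  assumes "z \<in> V"
  shows "sep V' E' w z = insert {w, y} (sep V E y z)"
proof (rule set_eqI)
  fix e
  show "e \<in> sep V' E' w z \<longleftrightarrow> e \<in> insert {w, y} (sep V E y z)"
  proof (cases "e \<in> E")
    case True
    then obtain u v where uv: "e = {u, v}" "u \<in> V" "v \<in> V" using simple_graph_edgeE[OF simple] by metis
    then have "u \<noteq> w" "v \<noteq> w" using w by auto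
    then show ?thesis using uv True assms y
      by (simp add: sep_doubleton_iff closer_def gdist_pendant doubleton_eq_iff)
  next
    case False
    then have "e \<notin> sep V E y z" by (simp add: sep_def)
    moreover have "{w, y} \<in> sep V' E' w z"
      using assms y by (simp add: sep_doubleton_iff closer_def gdist_pendant gdist_pendant_self
          gdist_self gdist_sym[of V E y z])
    moreover have "e \<in> sep V' E' w z \<Longrightarrow> e = {w, y}" using False by (simp add: sep_def)
    ultimately show ?thesis by blast
  qed
qed

lemma new_edge: "{w, y} \<notin> E"
  using edgeD w by blast

lemma excess_pendant:
  assumes "x \<in> V" "z \<in> V"
  shows "excess V' E' x z = excess V E x z"
  using assms by (simp add: excess_def sep_pendant gdist_pendant)

text \<open>Passing from \<open>y\<close> to \<open>w\<close> adds one to the distance and one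
  separating edge, which cancel.\<close>

lemma excess_pendant_leaf:
  assumes "z \<in> V"
  shows "excess V' E' w z = excess V E y z"
proof -
  have "{w, y} \<notin> sep V E y z" using new_edge by (simp add: sep_def)
  then show ?thesis
    using assms y finite_sep
    by (simp add: excess_def sep_pendant_leaf gdist_pendant gdist_sym[of V E y z])
qed

lemma bipartite_pendant:
  assumes "bipartite V E" shows "bipartite V' E'"
proof -
  obtain A B where AB: "A \<union> B = V" "A \<inter> B = {}" and ed: "\<forall>e\<in>E. \<exists>a\<in>A. \<exists>b\<in>B. e = {a, b}"
    using assms unfolding bipartite_def by (elim exE conjE)
  show ?thesis
  proof (cases "y \<in> A")
    case True
    have "\<forall>e\<in>E'. \<exists>a\<in>A. \<exists>b\<in>insert w B. e = {a, b}"
    proof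
      fix e assume "e \<in> E'"
      then consider "e = {y, w}" | "e \<in> E" by (auto simp: insert_commute)
      then show "\<exists>a\<in>A. \<exists>b\<in>insert w B. e = {a, b}" using ed True by cases blast+
    qed
    moreover have "A \<union> insert w B = V'" "A \<inter> insert w B = {}" using AB w by auto
    ultimately show ?thesis unfolding bipartite_def by blast
  next
    case False
    then have "y \<in> B" using AB y by blast
    then have "\<forall>e\<in>E'. \<exists>a\<in>insert w A. \<exists>b\<in>B. e = {a, b}" using ed by auto
    moreover have "insert w A \<union> B = V'" "insert w A \<inter> B = {}" using AB w by auto
    ultimately show ?thesis unfolding bipartite_def by blast
  qed
qed

end

text \<open>A vertex \<open>w\<close> farthest from \<open>x\<close> is a leaf: deleting it keeps
  the other vertices connected to \<open>x\<close>, and a second neighbour of \<open>w\<close> would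
  close a cycle. Keeping \<open>x\<close> allows the root to stay fixed while leaves are stripped
  off.\<close>

lemma tree_leaf:
  assumes T: "tree T D" and x: "x \<in> T" and nontriv: "T \<noteq> {x}"
  obtains w y D' where "w \<in> T" "w \<noteq> x" "y \<in> T" "y \<noteq> w" "D = insert {w, y} D'" "tree (T - {w}) D'"
proof -
  interpret fin_conn_graph T D using T by unfold_locales (auto simp: tree_def)
  obtain w where w: "w \<in> T" and far: "\<And>z. z \<in> T \<Longrightarrow> d x z \<le> d x w"
  proof -
    have "Max (d x ` T) \<in> d x ` T" using finite_V x by (intro Max_in) auto
    then obtain w where "w \<in> T" "d x w = Max (d x ` T)" by auto
    then show ?thesis using that finite_V by simp
  qed
  have wx: "w \<noteq> x"
  proof
    assume "w = x"
    obtain z where z: "z \<in> T" "z \<noteq> x" using nontriv x by blast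
    then have "d x z \<noteq> 0" using gdist_eq_0 x by blast
    then show False using far[OF z(1)] \<open>w = x\<close> gdist_self[OF x] by simp
  qed
  define D' where "D' = {e \<in> D. w \<notin> e}"
  have simple': "simple_graph (T - {w}) D'" using simple by (auto simp: D'_def simple_graph_def)
  \<comment> \<open>The old distance from \<open>x\<close> still serves as a potential: the
    predecessor of a vertex is strictly closer to \<open>x\<close> than the farthest vertex
    \<open>w\<close>, so it survives the deletion.\<close>
  have "walk_between (T - {w}) D' x z (d x z)" if z: "z \<in> T - {w}" for z
  proof (rule potential_walk[OF _ _ _ _ z])
    show "x \<in> T - {w}" "d x x = 0" using x wx gdist_self by auto
    show "d x v \<le> Suc (d x u)" if "{u, v} \<in> D'" for u v
      using that gdist_edge_le x by (simp add: D'_def)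
    show "\<exists>v\<in>T - {w}. {v, z} \<in> D' \<and> d x v < d x z" if z: "z \<in> T - {w}" "z \<noteq> x" for z
    proof -
      obtain v where v: "v \<in> T" "{v, z} \<in> D" "d x z = Suc (d x v)" using gdist_pred[OF x, of z] z by auto
      then have "v \<noteq> w" using far[of z] z by auto
      then show ?thesis using v z by (intro bexI[of _ v]) (auto simp: D'_def)
    qed
  qed
  then have conn': "connected_graph (T - {w}) D'"
    using x wx by (intro connected_graph_from_root[of x]) auto
  have tree': "tree (T - {w}) D'"
    using T simple' conn' unfolding tree_def acyclic_graph_def D'_def by blast
  obtain y where y: "y \<in> T" "{y, w} \<in> D" using gdist_pred[OF x w] wx by auto
  then have yw: "y \<noteq> w" using edgeD by blast
  have uniq: "u = y" if u: "{u, w} \<in> D" for u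
  proof (rule ccontr)
    assume uy: "u \<noteq> y"
    interpret T': fin_conn_graph "T - {w}" D' using simple' conn' by unfold_locales
    have uT: "u \<in> T - {w}" "y \<in> T - {w}" using edgeD[OF u] y yw by auto
    define k where "k = T'.d u y"
    obtain p where p: "T'.geodesic p k" "p 0 = u" "p k = y"
      using T'.geodesic_exists[OF uT] unfolding k_def by blast
    have k: "k \<ge> 1" using T'.gdist_eq_0[OF uT] uy by (simp add: k_def)
    \<comment> \<open>A geodesic from \<open>u\<close> to \<open>y\<close> avoiding
      \<open>w\<close>, closed up through \<open>w\<close>; its length \<open>k + 2\<close> is at
      least \<open>3\<close> because \<open>u\<close> and \<open>y\<close> differ.\<close>
    define vs where "vs = w # map p [0..<Suc k]"
    have pT: "p i \<in> T - {w}" if "i \<le> k" for i using p that by (simp add: T'.geodesic_def)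
    have len: "length vs = Suc (Suc k)" by (simp add: vs_def)
    have "distinct (map p [0..<Suc k])"
      using T'.geodesic_inj[OF p(1)] by (simp add: distinct_map atLeast0LessThan lessThan_Suc_atMost del: upt_Suc)
    moreover have "\<forall>i\<le>k. p i \<noteq> w" using pT by blast
    then have "w \<notin> set (map p [0..<Suc k])" by (auto simp: less_Suc_eq_le simp del: upt_Suc)
    ultimately have "distinct vs" unfolding vs_def by simp
    then have "cycle_graph (Suc (Suc k)) (set vs) (cycle_edges vs)"
      using k len unfolding cycle_graph_def by (intro conjI exI[of _ vs]) auto
    moreover have "set vs \<subseteq> T" using pT w by (auto simp: vs_def)
    moreover have "cycle_edges vs \<subseteq> D"
    proof
      fix e assume "e \<in> cycle_edges vs"
      then obtain i where i: "i < Suc (Suc k)" "e = {vs ! i, vs ! (Suc i mod Suc (Suc k))}"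
        unfolding cycle_edges_def len by blast
      have nth: "vs ! Suc j = p j" if "j \<le> k" for j
        using that by (simp add: vs_def nth_map del: upt_Suc)
      \<comment> \<open>The edge from \<open>w\<close> to \<open>u\<close>, the closing edge from
        \<open>y\<close> back to \<open>w\<close>, and the edges of the geodesic.\<close>
      consider "i = 0" | "i = Suc k" | j where "i = Suc j" "j < k" using i(1) by (cases i) (auto simp: less_Suc_eq)
      then show "e \<in> D"
      proof cases
        case 1
        then show ?thesis using i nth[of 0] p u by (simp add: vs_def insert_commute)
      next
        case 2
        then show ?thesis using i nth[of k] p y by (simp add: vs_def)
      next
        case (3 j)
        then have "e = {p j, p (Suc j)}" using i nth[of j] nth[of "Suc j"] by simp
        then have "e \<in> D'" using p 3 by (simp add: T'.geodesic_def)
        then show ?thesis by (simp add: D'_def)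
      qed
    qed
    ultimately show False using T unfolding tree_def acyclic_graph_def by blast
  qed
  have "D = insert {w, y} D'"
  proof (intro set_eqI iffI)
    fix e assume e: "e \<in> D"
    show "e \<in> insert {w, y} D'"
    proof (cases "w \<in> e")
      case True
      obtain a b where ab: "e = {a, b}" using simple_graph_edgeE[OF simple e] by metis
      then obtain u where "e = {u, w}" using True by (auto simp: insert_commute)
      then show ?thesis using uniq e by (auto simp: insert_commute)
    qed (use e in \<open>simp add: D'_def\<close>)
  qed (use y in \<open>auto simp: D'_def insert_commute\<close>)
  then show ?thesis using that w wx y yw tree' by blast
qed

subsection \<open>Four-cycles with a tree attached\<close>

lemma cycle_graph_4E:
  assumes "cycle_graph 4 C F"
  obtains a b c e where "distinct [a, b, c, e]" "C = {a, b, c, e}" "F = {{a, b}, {b, c}, {c, e}, {e, a}}"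
proof -
  obtain vs where vs: "distinct vs" "length vs = 4" "C = set vs" "F = cycle_edges vs"
    using assms by (auto simp: cycle_graph_def)
  obtain a b c e where abce: "vs = [a, b, c, e]"
    using vs(2) by (auto simp: numeral_eq_Suc length_Suc_conv)
  have I: "{i :: nat. i < 4} = {0, 1, 2, 3}" by auto
  have "(\<lambda>i. {vs ! i, vs ! (Suc i mod 4)}) ` {i. i < 4} = {{a, b}, {b, c}, {c, e}, {e, a}}"
    unfolding I by (simp add: abce)
  then have "cycle_edges vs = {{a, b}, {b, c}, {c, e}, {e, a}}"
    unfolding cycle_edges_def vs(2) by (simp add: setcompr_eq_image)
  then show ?thesis using that abce vs by simp
qed

lemma C4_walk_gdist:
  assumes dist: "distinct [a, b, c, e]" and C: "C = {a, b, c, e}"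
    and F: "F = {{a, b}, {b, c}, {c, e}, {e, a}}" and z: "z \<in> C"
  shows "walk_between C F a z (if z = a then 0 else if z = c then 2 else 1)"
    and "gdist C F a z = (if z = a then 0 else if z = c then 2 else 1)"
proof -
  let ?g = "\<lambda>z. if z = a then 0 else if z = c then 2 else 1 :: nat"
  have a: "a \<in> C" "?g a = 0" using C by auto
  have lip: "?g v \<le> Suc (?g u)" if "{u, v} \<in> F" for u v
    using that dist unfolding F by (auto simp: doubleton_eq_iff)
  have desc: "\<exists>v\<in>C. {v, z} \<in> F \<and> ?g v < ?g z" if "z \<in> C" "z \<noteq> a" for z
  proof (cases "z = c")
    case True
    then show ?thesis using dist by (intro bexI[of _ b]) (auto simp: C F)
  next
    case False
    then show ?thesis using that dist by (intro bexI[of _ a]) (auto simp: C F insert_commute)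
  qed
  show "walk_between C F a z (?g z)" using potential_walk[of a C ?g F, OF a lip desc z] .
  show "gdist C F a z = ?g z" using gdist_eq_potential[of a C ?g F, OF a lip desc z] .
qed

text \<open>Each neighbour of \<open>a\<close> is separated from it by two opposite edges at
  distance \<open>1\<close>, the antipode \<open>c\<close> by all four edges at distance
  \<open>2\<close>; this gives \<open>1 + 2 + 1\<close>.\<close>

lemma C4_sum_excess_row:
  assumes dist: "distinct [a, b, c, e]" and C: "C = {a, b, c, e}"
    and F: "F = {{a, b}, {b, c}, {c, e}, {e, a}}"
  shows "(\<Sum>z\<in>C. excess C F a z) = 4"
proof -
  have da: "gdist C F a z = (if z = a then 0 else if z = c then 2 else 1)" if "z \<in> C" for z
    using C4_walk_gdist(2)[OF dist C F that] .
  \<comment> \<open>The distances from the other vertices come from rotating the list, which leaves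
    \<open>C\<close> and \<open>F\<close> unchanged.\<close>
  have db: "gdist C F b z = (if z = b then 0 else if z = e then 2 else 1)" if "z \<in> C" for z
    by (rule C4_walk_gdist(2)[of b c e a, OF _ _ _ that]) (use dist in \<open>auto simp: C F\<close>)
  have dc: "gdist C F c z = (if z = c then 0 else if z = a then 2 else 1)" if "z \<in> C" for z
    by (rule C4_walk_gdist(2)[of c e a b, OF _ _ _ that]) (use dist in \<open>auto simp: C F\<close>)
  have de: "gdist C F e z = (if z = e then 0 else if z = b then 2 else 1)" if "z \<in> C" for z
    by (rule C4_walk_gdist(2)[of e a b c, OF _ _ _ that]) (use dist in \<open>auto simp: C F\<close>)
  have V: "a \<in> C" "b \<in> C" "c \<in> C" "e \<in> C" using C by auto
  have E: "{a, b} \<in> F" "{b, c} \<in> F" "{c, e} \<in> F" "{e, a} \<in> F" using F by auto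
  note D = da db dc de
  have sub: "f \<in> F" if "f \<in> sep C F u v" for f u v using that by (simp add: sep_def)
  have "{a, b} \<in> sep C F a b" "{c, e} \<in> sep C F a b" "{b, c} \<notin> sep C F a b" "{e, a} \<notin> sep C F a b"
    using dist V E by (auto simp: sep_doubleton_iff closer_def D)
  then have "sep C F a b = {{a, b}, {c, e}}" using sub[of _ a b] unfolding F by auto
  moreover have "{a, b} \<in> sep C F a c" "{c, e} \<in> sep C F a c" "{b, c} \<in> sep C F a c" "{e, a} \<in> sep C F a c"
    using dist V E by (auto simp: sep_doubleton_iff closer_def D)
  then have "sep C F a c = {{a, b}, {b, c}, {c, e}, {e, a}}" using sub[of _ a c] unfolding F by auto
  moreover have "{a, b} \<notin> sep C F a e" "{c, e} \<notin> sep C F a e" "{b, c} \<in> sep C F a e" "{e, a} \<in> sep C F a e"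
    using dist V E by (auto simp: sep_doubleton_iff closer_def D)
  then have "sep C F a e = {{b, c}, {e, a}}" using sub[of _ a e] unfolding F by auto
  ultimately have "excess C F a b = 1" "excess C F a c = 2" "excess C F a e = 1"
    using dist V by (auto simp: excess_def da doubleton_eq_iff card_insert_if)
  moreover have "excess C F a a = 0" using excess_self V by metis
  ultimately show ?thesis using dist by (simp add: C)
qed

lemma C4_properties:
  assumes "cycle_graph 4 C F"
  shows "simple_graph C F" "connected_graph C F" "bipartite C F" "card C = 4" "card F = 4"
    and "\<And>y. y \<in> C \<Longrightarrow> (\<Sum>z\<in>C. excess C F y z) = 4"
proof -
  obtain a b c e where dist: "distinct [a, b, c, e]" and C: "C = {a, b, c, e}"
    and F: "F = {{a, b}, {b, c}, {c, e}, {e, a}}" using cycle_graph_4E[OF assms] .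
  show "simple_graph C F" using dist by (auto simp: simple_graph_def C F)
  show "connected_graph C F"
    using C4_walk_gdist(1)[OF dist C F] C by (intro connected_graph_from_root[of a]) auto
  have "{a, c} \<union> {b, e} = C" "{a, c} \<inter> {b, e} = {}" using dist C by auto
  moreover have "\<forall>f\<in>F. \<exists>u\<in>{a, c}. \<exists>v\<in>{b, e}. f = {u, v}" by (auto simp: F insert_commute)
  ultimately show "bipartite C F" unfolding bipartite_def by blast
  show "card C = 4" "card F = 4" using dist by (auto simp: C F doubleton_eq_iff card_insert_if)
  fix y assume "y \<in> C"
  then consider "y = a" | "y = b" | "y = c" | "y = e" using C by auto
  then show "(\<Sum>z\<in>C. excess C F y z) = 4"
  proof cases
    case 1
    then show ?thesis using C4_sum_excess_row[OF dist C F] by simp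
  next
    case 2
    show ?thesis unfolding 2 by (rule C4_sum_excess_row[of b c e a]) (use dist in \<open>auto simp: C F\<close>)
  next
    case 3
    show ?thesis unfolding 3 by (rule C4_sum_excess_row[of c e a b]) (use dist in \<open>auto simp: C F\<close>)
  next
    case 4
    show ?thesis unfolding 4 by (rule C4_sum_excess_row[of e a b c]) (use dist in \<open>auto simp: C F\<close>)
  qed
qed

text \<open>Induction by stripping leaves other than \<open>x\<close>, so that the leaf
  \<open>w\<close> lies off \<open>C\<close> and the smaller tree still meets \<open>C\<close> in
  \<open>x\<close> only. The structural facts are carried along because attaching \<open>w\<close>
  again needs a simple connected graph; all excesses of \<open>w\<close> with old vertices are those
  of its neighbour \<open>y\<close> in the tree.\<close>

lemma C4_tree_properties:
  assumes C4: "cycle_graph 4 C F" and T: "tree T D" and x: "C \<inter> T = {x}"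
  shows "simple_graph (C \<union> T) (F \<union> D) \<and> connected_graph (C \<union> T) (F \<union> D) \<and>
    bipartite (C \<union> T) (F \<union> D) \<and> card (F \<union> D) = card (C \<union> T) \<and>
    (\<forall>y\<in>C \<union> T. (\<Sum>z\<in>C. excess (C \<union> T) (F \<union> D) y z) = 4) \<and>
    (\<forall>y\<in>T. \<forall>z\<in>T. excess (C \<union> T) (F \<union> D) y z = 0)"
  using T x
proof (induction "card T" arbitrary: T D rule: less_induct)
  case less
  have xT: "x \<in> T" "x \<in> C" using less.prems by auto
  show ?case
  proof (cases "T = {x}")
    case True
    have "e \<notin> D" for e
    proof
      assume "e \<in> D"
      then have "e \<subseteq> {x}" "card e = 2"
        using less.prems(1) True by (auto simp: tree_def simple_graph_def)
      then show False using card_mono[of "{x}" e] by simp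
    qed
    then have "D = {}" by blast
    moreover have "C \<union> T = C" using True xT by auto
    ultimately show ?thesis
      using C4_properties[OF C4] True excess_self[OF xT(2)] by simp
  next
    case False
    obtain w y D' where wy: "w \<in> T" "w \<noteq> x" "y \<in> T" "y \<noteq> w" "D = insert {w, y} D'"
      and T': "tree (T - {w}) D'"
      using tree_leaf[OF less.prems(1) xT(1) False] by metis
    have fin: "finite T" "finite C"
      using less.prems(1) C4_properties(1)[OF C4] by (auto simp: tree_def simple_graph_def)
    have x': "C \<inter> (T - {w}) = {x}" using less.prems(2) wy by auto
    have lt: "card (T - {w}) < card T" using fin wy by (meson card_Diff1_less)
    define U where "U = C \<union> (T - {w})"
    define H where "H = F \<union> D'"
    note IH = less.hyps[OF lt T' x', folded U_def H_def]
    have wC: "w \<notin> C" using less.prems(2) wy by auto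
    have wU: "w \<notin> U" "y \<in> U" using wC wy by (auto simp: U_def)
    interpret pendant U H w y using IH wU by unfold_locales auto
    have eq: "C \<union> T = V'" "F \<union> D = E'" using wy by (auto simp: U_def H_def)
    have cU: "C \<subseteq> U" by (auto simp: U_def)
    have card: "card E' = card V'"
      using IH new_edge w finite_V finite_edges[OF simple] by simp
    have rows: "(\<Sum>z\<in>C. excess V' E' u z) = 4" if "u \<in> V'" for u
    proof (cases "u = w")
      case True
      have "(\<Sum>z\<in>C. excess V' E' u z) = (\<Sum>z\<in>C. excess U H y z)"
        using True cU excess_pendant_leaf by (intro sum.cong) auto
      then show ?thesis using IH y by simp
    next
      case False
      then have u: "u \<in> U" using that by simp
      have "(\<Sum>z\<in>C. excess V' E' u z) = (\<Sum>z\<in>C. excess U H u z)"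
        using u cU excess_pendant by (intro sum.cong) auto
      then show ?thesis using IH u by simp
    qed
    have zero: "excess V' E' u v = 0" if uv: "u \<in> T" "v \<in> T" for u v
    proof -
      have TU: "z \<in> U \<and> z \<in> T - {w}" if "z \<in> T" "z \<noteq> w" for z using that by (auto simp: U_def)
      have 0: "excess U H s t = 0" if "s \<in> T - {w}" "t \<in> T - {w}" for s t using IH that by blast
      have leaf: "excess V' E' w z = 0" if "z \<in> T" "z \<noteq> w" for z
        using excess_pendant_leaf[of z] TU[OF that] 0[of y z] wy by simp
      show ?thesis
      proof (cases "u = w \<or> v = w")
        case True
        then show ?thesis
          using leaf uv excess_self[of w V' E'] excess_sym[of V' E' u v] by (metis insertI1)
      next
        case False
        then show ?thesis using excess_pendant[of u v] TU[of u] TU[of v] uv 0 by simp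
      qed
    qed
    show ?thesis
      unfolding eq using simple_pendant connected_pendant bipartite_pendant IH card rows zero by blast
  qed
qed

text \<open>Each of the \<open>n\<close> rows over \<open>C\<close> sums up to \<open>4\<close>. The
  \<open>n - 4\<close> vertices off \<open>C\<close> lie in \<open>T\<close> and have excess
  \<open>0\<close> with each other, so each of their columns sums up to \<open>4\<close> too; the
  total \<open>8 * n - 16\<close> is twice the claimed value.\<close>

lemma C4_tree_graph_szeged_wiener:
  assumes n: "n \<ge> 4" and G: "C4_tree_graph n V E"
  shows "simple_graph V E" "connected_graph V E" "bipartite V E" "card V = n" "card E = n"
    "int (szeged_index V E) - int (wiener_index V E) = 4 * int n - 8"
proof -
  obtain C F T D x where C4: "cycle_graph 4 C F" and T: "tree T D" "card T = n - 3" and x: "C \<inter> T = {x}"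
    and VE: "V = C \<union> T" "E = F \<union> D"
    using G by (auto simp: C4_tree_graph_def)
  note P = C4_tree_properties[OF C4 T(1) x, folded VE]
  show "simple_graph V E" "connected_graph V E" "bipartite V E" using P by auto
  interpret fin_conn_graph V E using P by unfold_locales auto
  have CT: "finite C" "finite T" "card C = 4"
    using finite_V VE C4_properties(4)[OF C4] by auto
  have "card C + card T = card V + 1" using card_Un_Int[OF CT(1,2)] x VE by simp
  then show cardV: "card V = n" using CT T n by simp
  then show "card E = n" using P by simp
  have CV: "C \<subseteq> V" and VC: "V - C \<subseteq> T" using VE by auto
  have split: "(\<Sum>y\<in>V. excess V E u y) = (\<Sum>y\<in>V - C. excess V E u y) + (\<Sum>y\<in>C. excess V E u y)" for u
    by (rule sum.subset_diff[OF CV finite_V])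
  have row: "(\<Sum>y\<in>C. excess V E u y) = 4" if "u \<in> V" for u using P that by blast
  have "(\<Sum>u\<in>V. \<Sum>y\<in>V - C. excess V E u y) = (\<Sum>y\<in>V - C. \<Sum>u\<in>V. excess V E y u)"
    by (subst sum.swap) (simp add: excess_sym)
  also have "\<dots> = (\<Sum>y\<in>V - C. 4)"
  proof (rule sum.cong[OF refl])
    fix y assume y: "y \<in> V - C"
    have "(\<Sum>u\<in>V - C. excess V E y u) = 0" using P y VC by (intro sum.neutral) blast
    then show "(\<Sum>u\<in>V. excess V E y u) = 4" using split[of y] row[of y] y by simp
  qed
  also have "\<dots> = 4 * (int n - 4)"
    using card_Diff_subset[OF CT(1) CV] CT cardV n by (simp add: of_nat_diff)
  finally have "(\<Sum>u\<in>V. \<Sum>y\<in>V. excess V E u y) = 4 * (int n - 4) + 4 * int n"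
    using row cardV by (simp add: split sum.distrib)
  then show "int (szeged_index V E) - int (wiener_index V E) = 4 * int n - 8"
    using sum_excess by simp
qed

section \<open>Existence of the extremal graphs\<close>

lemma star_tree:
  fixes x :: 'a
  assumes "finite L" "x \<notin> L"
  shows "tree (insert x L) ((\<lambda>i. {x, i}) ` L)"
  unfolding tree_def
proof (intro conjI)
  let ?T = "insert x L" and ?D = "(\<lambda>i. {x, i}) ` L"
  show "simple_graph ?T ?D" using assms by (auto simp: simple_graph_def card_2_iff)
  show "connected_graph ?T ?D"
  proof (rule connected_graph_from_root[of x])
    fix z assume z: "z \<in> ?T"
    show "\<exists>k. walk_between ?T ?D x z k"
    proof (cases "z = x")
      case True
      then have "walk_between ?T ?D x z 0" by (simp add: walk_between_0)
      then show ?thesis by blast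
    next
      case False
      then have "walk_between ?T ?D x z (Suc 0)" using z by (auto simp: walk_between_Suc walk_between_0)
      then show ?thesis by blast
    qed
  qed simp
  show "acyclic_graph ?T ?D"
    unfolding acyclic_graph_def
  proof
    assume "\<exists>k C F. cycle_graph k C F \<and> C \<subseteq> ?T \<and> F \<subseteq> ?D"
    then obtain vs :: "'a list" where vs: "distinct vs" "length vs \<ge> 3" "cycle_edges vs \<subseteq> ?D"
      by (auto simp: cycle_graph_def)
    let ?n = "length vs"
    have centre: "vs ! i = x \<or> vs ! (Suc i mod ?n) = x" if "i < ?n" for i
    proof -
      have "{vs ! i, vs ! (Suc i mod ?n)} \<in> ?D" using vs that by (auto simp: cycle_edges_def)
      then show ?thesis by (auto simp: doubleton_eq_iff)
    qed
    have neq: "vs ! i \<noteq> vs ! j" if "i < ?n" "j < ?n" "i \<noteq> j" for i j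
      using vs(1) that by (simp add: nth_eq_iff_index_eq)
    have ne: "vs \<noteq> []" using vs(2) by auto
    \<comment> \<open>Every edge of a star contains its centre, but no single position of the cycle
      lies on all of its first three edges. In a triangle the index \<open>3\<close> wraps around to
      \<open>0\<close>.\<close>
    have "vs ! 0 = x \<or> vs ! 1 = x" "vs ! 1 = x \<or> vs ! 2 = x" "vs ! 2 = x \<or> vs ! (3 mod ?n) = x"
      using centre[of 0] centre[of 1] centre[of 2] vs(2) ne by (auto simp: numeral_eq_Suc)
    moreover have "3 mod ?n < ?n" "3 mod ?n \<noteq> 1" using vs(2) by (cases "?n = 3"; simp)+
    ultimately show False
      using neq[of 0 2] neq[of 1 2] neq[of 1 "3 mod ?n"] vs(2) ne by auto
  qed
qed

text \<open>Keeps the equality statement from being vacuous: a star centred at \<open>0\<close> with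
  leaves \<open>4, ..., n - 1\<close> has \<open>n - 3\<close> vertices and meets the cycle on
  \<open>0, 1, 2, 3\<close> in \<open>0\<close> only.\<close>

lemma C4_tree_graph_exists:
  assumes "n \<ge> 4"
  shows "\<exists>(V :: nat set) E. C4_tree_graph n V E"
proof -
  let ?L = "{4..<n}"
  have "cycle_graph 4 (set [0, 1, 2, 3 :: nat]) (cycle_edges [0, 1, 2, 3])"
    unfolding cycle_graph_def by (intro conjI exI[of _ "[0, 1, 2, 3]"]) auto
  moreover have "tree (insert 0 ?L) ((\<lambda>i. {0, i}) ` ?L)" by (rule star_tree) auto
  moreover have "card (insert 0 ?L) = n - 3" using assms by simp
  moreover have "set [0, 1, 2, 3 :: nat] \<inter> insert 0 ?L = {0}" by auto
  ultimately show ?thesis unfolding C4_tree_graph_def by blast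
qed

theorem theorem2p2:
  fixes n :: nat
  assumes "n \<ge> 4"
  shows "(\<forall>(V :: 'a set) E.
            simple_graph V E \<and> connected_graph V E \<and> bipartite V E \<and>
            card V = n \<and> card E \<ge> n \<longrightarrow>
            int (szeged_index V E) - int (wiener_index V E) \<ge> 4 * int n - 8) \<and>
         (\<forall>(V :: 'a set) E.
            C4_tree_graph n V E \<longrightarrow>
            simple_graph V E \<and> connected_graph V E \<and> bipartite V E \<and>
            card V = n \<and> card E \<ge> n \<and>
            int (szeged_index V E) - int (wiener_index V E) = 4 * int n - 8) \<and>
         (\<exists>(V :: nat set) E. C4_tree_graph n V E)"
proof (intro conjI allI impI)
  fix V :: "'a set" and E
  assume G: "simple_graph V E \<and> connected_graph V E \<and> bipartite V E \<and> card V = n \<and> card E \<ge> n"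
  then interpret bip_conn_graph V E by unfold_locales auto
  show "int (szeged_index V E) - int (wiener_index V E) \<ge> 4 * int n - 8"
    using szeged_wiener_ge G by simp
next
  fix V :: "'a set" and E
  assume "C4_tree_graph n V E"
  note P = C4_tree_graph_szeged_wiener[OF assms this]
  show "simple_graph V E" "connected_graph V E" "bipartite V E" "card V = n" "card E \<ge> n"
    "int (szeged_index V E) - int (wiener_index V E) = 4 * int n - 8"
    using P by simp_all
qed (rule C4_tree_graph_exists[OF assms])

end
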